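(* Let $d\ge2$, let $O\subseteq\mathbb R^d$ be open and $D\subseteq\partial O$ closed. Suppose that $O$ satisfies (UITC) and consists of only one component. Then $\mathrm{BMO}_D$ is the dual space of $\mathrm H^1_D$ in the following sense, with constants $c$ independent of $g$ and $\ell$: (i) For each $g\in\mathrm{BMO}_D$, the functional $\ell_g(f)=\int_Ogf\,dx$, $f\in\mathrm H^1_{D,a}$, extends to a bounded linear functional on $\mathrm H^1_D$, and $\|\ell_g\|_{(\mathrm H^1_D)^*}\le c\|g\|_{\mathrm{BMO}_D}$. (ii) For each $\ell\in(\mathrm H^1_D)^*$ there is a unique $h\in\mathrm{BMO}_D$ (unique modulo functions of vanishing $\mathrm{BMO}_D$-seminorm) such that $\ell=\ell_h$, and $\|h\|_{\mathrm{BMO}_D}\le c\|\ell\|_{(\mathrm H^1_D)^*}$.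
   Context: $\mathrm B(x,r)$ is the Euclidean ball and $\mathrm d(O)=\operatorname{diam}(O)\in(0,\infty]$. (UITC): $\exists c>0\ \forall x\in O,\ r<\mathrm d(O)$: $|\mathrm B(x,r)\cap O|\ge cr^d$. Components: let $\{O_m\}_{m\in I}$ enumerate the bounded connected components $O'$ of $O$ with $\partial O'\cap D=\varnothing$, and $O_D=O\setminus\bigcup_mO_m$. The components of $O$ are the nonempty sets among $O_D$ and the $O_m$; here there is exactly one, namely $O$ itself. Balls and atoms: for $x$ in a component $O'$ and $r>0$ put $B^\Sigma(x,r)=\mathrm B(x,r)\cap O'$ (a usual ball); it is near $D$ if $\mathrm B(x,2r)\cap(D\cap\partial O')\ne\varnothing$. A measurable $a:O\to\mathbb C$ is an $\mathrm H^1_D$-atom if for some usual ball $B$ one has $\operatorname{supp}a\subseteq\overline B$, $\|a\|_2\le|B|^{-1/2}$, and either $\int_Oa=0$ or $B$ is near $D$. $\mathrm H^1_D$ consists of all $f=\sum_j\lambda_ja_j$ (a.e.) with $(\lambda_j)\in\ell^1$ and $\mathrm H^1_D$-atoms $a_j$, with norm $\inf\|(\lambda_j)\|_{\ell^1}$; $\mathrm H^1_{D,a}$ is the dense subspace of finite linear combinations of $\mathrm H^1_D$-atoms. $\mathrm{BMO}_D$: all measurable $f$ that are square integrable on bounded subsets of $O$ and for which $\|f\|_{\mathrm{BMO}_D}=\max\Big\{\sup_{B\text{ usual}}\Big(\frac1{|B|}\int_B|f-(f)_B|^2\Big)^{1/2},\ \sup_{B\text{ near }D}\Big(\frac1{|B|}\int_B|f|^2\Big)^{1/2}\Big\}<\infty$,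 where $(f)_B=\frac1{|B|}\int_Bf$. This is in general only a seminorm. *)

theory Defs
  imports "HOL-Analysis.Analysis"
begin

text \<open>
  Euclidean space of dimension \<open>d\<close> is a type of class \<open>euclidean_space\<close>, with \<open>d = DIM('a)\<close>.
  A function on an open set \<open>O\<close> (written \<open>\<Omega>\<close> below) is represented by a function on the
  whole space of which only the values on \<open>\<Omega>\<close> matter; functions that agree almost everywhere
  on \<open>\<Omega>\<close> are not identified by a quotient, but no notion below distinguishes between them.
\<close>

text \<open>Extended-valued, because the library's \<open>diameter\<close> is \<open>0\<close> on unbounded sets.\<close>

definition ediam :: "'a::metric_space set \<Rightarrow> ereal" where
  "ediam S = (SUP x\<in>S. SUP y\<in>S. ereal (dist x y))"

definition UITC :: "'a::euclidean_space set \<Rightarrow> bool" where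
  "UITC \<Omega> \<longleftrightarrow>
     (\<exists>c>0. \<forall>x\<in>\<Omega>. \<forall>r>0. ereal r < ediam \<Omega> \<longrightarrow>
        measure lebesgue (ball x r \<inter> \<Omega>) \<ge> c * r ^ DIM('a))"

definition free_parts :: "'a::euclidean_space set \<Rightarrow> 'a set \<Rightarrow> 'a set set" where
  "free_parts \<Omega> D = {C \<in> components \<Omega>. bounded C \<and> frontier C \<inter> D = {}}"

definition dirichlet_part :: "'a::euclidean_space set \<Rightarrow> 'a set \<Rightarrow> 'a set" where
  "dirichlet_part \<Omega> D = \<Omega> - \<Union>(free_parts \<Omega> D)"

text \<open>The components relative to \<open>D\<close>, as opposed to the connected \<open>components\<close> of the library:
  the part \<open>dirichlet_part \<Omega> D\<close> counts as one component and need not be connected.\<close>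

definition D_components :: "'a::euclidean_space set \<Rightarrow> 'a set \<Rightarrow> 'a set set" where
  "D_components \<Omega> D = insert (dirichlet_part \<Omega> D) (free_parts \<Omega> D) - {{}}"

text \<open>A usual ball is recorded as a triple of component, centre and radius, since
  being near \<open>D\<close> depends on these data and not only on the underlying set.\<close>

definition usual_balls :: "'a::euclidean_space set \<Rightarrow> 'a set \<Rightarrow> ('a set \<times> 'a \<times> real) set" where
  "usual_balls \<Omega> D = {(C, x, r). C \<in> D_components \<Omega> D \<and> x \<in> C \<and> r > 0}"

definition near_balls :: "'a::euclidean_space set \<Rightarrow> 'a set \<Rightarrow> ('a set \<times> 'a \<times> real) set" where
  "near_balls \<Omega> D =
     {(C, x, r) \<in> usual_balls \<Omega> D. ball x (2 * r) \<inter> (D \<inter> frontier C) \<noteq> {}}"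

fun ball_set :: "'a::euclidean_space set \<times> 'a \<times> real \<Rightarrow> 'a set" where
  "ball_set (C, x, r) = ball x r \<inter> C"

text \<open>Support of an almost-everywhere class of functions on \<open>\<Omega>\<close>.\<close>

definition ess_support :: "'a::euclidean_space set \<Rightarrow> ('a \<Rightarrow> complex) \<Rightarrow> 'a set" where
  "ess_support \<Omega> f =
     {x \<in> \<Omega>. \<forall>U. open U \<and> x \<in> U \<longrightarrow> \<not> (AE y in lebesgue_on (\<Omega> \<inter> U). f y = 0)}"

definition H1_atom :: "'a::euclidean_space set \<Rightarrow> 'a set \<Rightarrow> ('a \<Rightarrow> complex) \<Rightarrow> bool" where
  "H1_atom \<Omega> D a \<longleftrightarrow>
     a \<in> borel_measurable (lebesgue_on \<Omega>) \<and>
     (\<exists>B\<in>usual_balls \<Omega> D.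
        ess_support \<Omega> a \<subseteq> closure (ball_set B) \<and>
        integrable (lebesgue_on \<Omega>) (\<lambda>x. (norm (a x))\<^sup>2) \<and>
        sqrt (LINT x|lebesgue_on \<Omega>. (norm (a x))\<^sup>2) \<le> measure lebesgue (ball_set B) powr (-1/2) \<and>
        ((LINT x|lebesgue_on \<Omega>. a x) = 0 \<or> B \<in> near_balls \<Omega> D))"

definition atomic_decomp ::
  "'a::euclidean_space set \<Rightarrow> 'a set \<Rightarrow> ('a \<Rightarrow> complex) \<Rightarrow>
   (nat \<Rightarrow> complex) \<Rightarrow> (nat \<Rightarrow> 'a \<Rightarrow> complex) \<Rightarrow> bool" where
  "atomic_decomp \<Omega> D f l a \<longleftrightarrow>
     summable (\<lambda>j. norm (l j)) \<and> (\<forall>j. H1_atom \<Omega> D (a j)) \<and>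
     (AE x in lebesgue_on \<Omega>. (\<lambda>j. l j * a j x) sums f x)"

definition H1 :: "'a::euclidean_space set \<Rightarrow> 'a set \<Rightarrow> ('a \<Rightarrow> complex) set" where
  "H1 \<Omega> D = {f. \<exists>l a. atomic_decomp \<Omega> D f l a}"

definition H1_norm :: "'a::euclidean_space set \<Rightarrow> 'a set \<Rightarrow> ('a \<Rightarrow> complex) \<Rightarrow> real" where
  "H1_norm \<Omega> D f = Inf {(\<Sum>j. norm (l j)) | l a. atomic_decomp \<Omega> D f l a}"

definition H1_fin :: "'a::euclidean_space set \<Rightarrow> 'a set \<Rightarrow> ('a \<Rightarrow> complex) set" where
  "H1_fin \<Omega> D =
     {f. \<exists>n (l :: nat \<Rightarrow> complex) a. (\<forall>j<n. H1_atom \<Omega> D (a j)) \<and>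
           (AE x in lebesgue_on \<Omega>. f x = (\<Sum>j<n. l j * a j x))}"

text \<open>Bounded complex-linear functionals on \<open>H1 \<Omega> D\<close>. Boundedness forces them to agree on
  functions that are equal almost everywhere on \<open>\<Omega>\<close>; their values outside \<open>H1 \<Omega> D\<close> are
  irrelevant.\<close>

definition H1_dual ::
  "'a::euclidean_space set \<Rightarrow> 'a set \<Rightarrow> (('a \<Rightarrow> complex) \<Rightarrow> complex) set" where
  "H1_dual \<Omega> D =
     {L. (\<forall>f\<in>H1 \<Omega> D. \<forall>g\<in>H1 \<Omega> D. L (\<lambda>x. f x + g x) = L f + L g) \<and>
         (\<forall>f\<in>H1 \<Omega> D. \<forall>z. L (\<lambda>x. z * f x) = z * L f) \<and>
         (\<exists>K. \<forall>f\<in>H1 \<Omega> D. norm (L f) \<le> K * H1_norm \<Omega> D f)}"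

definition H1_dual_norm ::
  "'a::euclidean_space set \<Rightarrow> 'a set \<Rightarrow> (('a \<Rightarrow> complex) \<Rightarrow> complex) \<Rightarrow> real" where
  "H1_dual_norm \<Omega> D L = (SUP f\<in>{f \<in> H1 \<Omega> D. H1_norm \<Omega> D f \<le> 1}. norm (L f))"

definition mean :: "'a::euclidean_space set \<Rightarrow> ('a \<Rightarrow> complex) \<Rightarrow> complex" where
  "mean B f = (1 / measure lebesgue B) *\<^sub>R (LINT x|lebesgue_on B. f x)"

definition L2_mean :: "'a::euclidean_space set \<Rightarrow> ('a \<Rightarrow> complex) \<Rightarrow> real" where
  "L2_mean B f = sqrt (1 / measure lebesgue B * (LINT x|lebesgue_on B. (norm (f x))\<^sup>2))"

text \<open>Only meaningful for functions that are square integrable on bounded subsets of \<open>\<Omega>\<close>.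
  If no ball is near \<open>D\<close>, the second supremum is \<open>0\<close>.\<close>

definition BMO_seminorm :: "'a::euclidean_space set \<Rightarrow> 'a set \<Rightarrow> ('a \<Rightarrow> complex) \<Rightarrow> ennreal" where
  "BMO_seminorm \<Omega> D f =
     max (SUP B\<in>usual_balls \<Omega> D.
            ennreal (L2_mean (ball_set B) (\<lambda>x. f x - mean (ball_set B) f)))
         (SUP B\<in>near_balls \<Omega> D. ennreal (L2_mean (ball_set B) f))"

definition BMO :: "'a::euclidean_space set \<Rightarrow> 'a set \<Rightarrow> ('a \<Rightarrow> complex) set" where
  "BMO \<Omega> D =
     {f. f \<in> borel_measurable (lebesgue_on \<Omega>) \<and>
         (\<forall>S\<in>sets lebesgue. bounded S \<and> S \<subseteq> \<Omega> \<longrightarrow>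
            integrable (lebesgue_on S) (\<lambda>x. (norm (f x))\<^sup>2)) \<and>
         BMO_seminorm \<Omega> D f < \<infinity>}"

text \<open>\<open>L\<close> restricts on finite linear combinations of atoms to the functional that integrates
  against \<open>g\<close>. For \<open>L\<close> in \<open>H1_dual \<Omega> D\<close> this says \<open>L = \<ell>\<^sub>g\<close>, because \<open>H1_fin \<Omega> D\<close> is dense.
  The integrability clause makes the integral a genuine one.\<close>

definition represented_by ::
  "'a::euclidean_space set \<Rightarrow> 'a set \<Rightarrow> (('a \<Rightarrow> complex) \<Rightarrow> complex) \<Rightarrow> ('a \<Rightarrow> complex) \<Rightarrow> bool" where
  "represented_by \<Omega> D L g \<longleftrightarrow>
     (\<forall>f\<in>H1_fin \<Omega> D. integrable (lebesgue_on \<Omega>) (\<lambda>x. g x * f x) \<and>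
        L f = (LINT x|lebesgue_on \<Omega>. g x * f x))"

end

theory Submission
  imports Defs
begin

text \<open>
  A function in \<open>BMO\<close> pairs with an atom by Cauchy-Schwarz on the ball of the atom. Since the finite
  atomic norm is not the norm of \<open>H1\<close>, boundedness of the pairing needs an argument: projecting the
  values of \<open>g\<close> radially onto a disc of radius \<open>n\<close> is a contraction fixing \<open>0\<close>, so it does not
  increase mean oscillations, and bounded functions may be paired termwise with infinite atomic
  decompositions. The functional is the limit of these pairings as \<open>n\<close> tends to infinity.

  Conversely, exhaust \<open>\<Omega>\<close> by balls \<open>S n\<close>, which are near \<open>D\<close> unless \<open>D\<close> is empty. A functional on
  \<open>H1\<close>, composed with \<open>f \<mapsto> f - (\<integral>f) \<phi>\<close> for a normalised indicator \<open>\<phi>\<close> if only mean-zero atoms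
  exist, is bounded on \<open>L\<^sup>2(S n)\<close>. The Riesz representatives on the \<open>S n\<close> are compatible and glue to a
  function \<open>h\<close>. Testing against \<open>cnj (h - c)\<close> on a ball, where \<open>c\<close> is the mean of \<open>h\<close> or \<open>0\<close>, bounds
  the \<open>BMO\<close> seminorm of \<open>h\<close>; the same test applied to a difference gives uniqueness.
\<close>

subsection \<open>Square-integrable functions and the Riesz representation\<close>

text \<open>Plain functions rather than classes modulo null sets, so \<open>nrm2\<close> is a
  seminorm, and limits and representatives below are determined only almost everywhere.\<close>

definition sqint :: "'b measure \<Rightarrow> ('b \<Rightarrow> complex) set" where
  "sqint M = {f \<in> borel_measurable M. integrable M (\<lambda>x. (norm (f x))\<^sup>2)}"

definition nrm2 :: "'b measure \<Rightarrow> ('b \<Rightarrow> complex) \<Rightarrow> real" where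
  "nrm2 M f = sqrt (LINT x|M. (norm (f x))\<^sup>2)"

lemma sqint_measurable [measurable_dest]: "f \<in> sqint M \<Longrightarrow> f \<in> borel_measurable M"
  and sqint_integrable: "f \<in> sqint M \<Longrightarrow> integrable M (\<lambda>x. (norm (f x))\<^sup>2)"
  by (simp_all add: sqint_def)

lemma nrm2_nonneg [simp]: "0 \<le> nrm2 M f"
  by (simp add: nrm2_def)

lemma nrm2_power2: "(nrm2 M f)\<^sup>2 = (LINT x|M. (norm (f x))\<^sup>2)"
  by (simp add: nrm2_def)

lemma nn_integral_sqint:
  assumes "f \<in> sqint M"
  shows "(\<integral>\<^sup>+x. (ennreal (norm (f x)))\<^sup>2 \<partial>M) = ennreal ((nrm2 M f)\<^sup>2)"
  using nn_integral_eq_integral[OF sqint_integrable[OF assms]]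
  by (simp add: nrm2_power2 ennreal_power)

text \<open>The form in which Fatou's lemma delivers its bound: an extended integral of a function
  not yet known to be square integrable.\<close>

lemma sqintI_nn_integral:
  assumes f: "f \<in> borel_measurable M"
    and le: "(\<integral>\<^sup>+x. (ennreal (norm (f x)))\<^sup>2 \<partial>M) \<le> ennreal (r\<^sup>2)" and r: "0 \<le> r"
  shows "f \<in> sqint M" and "nrm2 M f \<le> r"
proof -
  have "(\<integral>\<^sup>+x. ennreal (norm ((norm (f x))\<^sup>2)) \<partial>M) < \<infinity>"
    using le_less_trans[OF le] by (simp add: ennreal_power)
  then have i: "integrable M (\<lambda>x. (norm (f x))\<^sup>2)"
    using f by (intro integrableI_bounded) auto
  then show s: "f \<in> sqint M"
    using f by (simp add: sqint_def)
  have "ennreal ((nrm2 M f)\<^sup>2) \<le> ennreal (r\<^sup>2)"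
    using le nn_integral_sqint[OF s] by simp
  then show "nrm2 M f \<le> r"
    using r by (simp add: power2_le_iff_abs_le)
qed

lemma sqint_mult_integrable:
  assumes "f \<in> sqint M" "g \<in> sqint M"
  shows "integrable M (\<lambda>x. f x * g x)"
proof (rule Bochner_Integration.integrable_bound)
  show "integrable M (\<lambda>x. (norm (f x))\<^sup>2 + (norm (g x))\<^sup>2)"
    using assms by (intro Bochner_Integration.integrable_add sqint_integrable)
  show "(\<lambda>x. f x * g x) \<in> borel_measurable M"
    using assms[THEN sqint_measurable] by measurable
  have "a * b \<le> a\<^sup>2 + b\<^sup>2" if "0 \<le> a" "0 \<le> b" for a b :: real
    using sum_squares_bound[of a b] mult_nonneg_nonneg[OF that] by linarith
  then show "AE x in M. norm (f x * g x) \<le> norm ((norm (f x))\<^sup>2 + (norm (g x))\<^sup>2)"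
    by (simp add: norm_mult)
qed

text \<open>Transferred from the inequality for nonnegative extended integrals. The modulus stays
  inside the integral, so pairing with the constant 1 also bounds L^1 norms.\<close>

lemma sqint_Cauchy_Schwarz:
  assumes f: "f \<in> sqint M" and g: "g \<in> sqint M"
  shows "(LINT x|M. norm (f x * g x)) \<le> nrm2 M f * nrm2 M g"
proof -
  note [measurable] = assms[THEN sqint_measurable]
  let ?I = "LINT x|M. norm (f x * g x)"
  have "(\<integral>\<^sup>+x. ennreal (norm (f x)) * ennreal (norm (g x)) \<partial>M) = ennreal ?I"
    using nn_integral_eq_integral[OF integrable_norm[OF sqint_mult_integrable[OF f g]]]
    by (simp add: norm_mult ennreal_mult)
  then have "(ennreal ?I)\<^sup>2 \<le> ennreal ((nrm2 M f)\<^sup>2) * ennreal ((nrm2 M g)\<^sup>2)"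
    using Cauchy_Schwarz_nn_integral[of "\<lambda>x. ennreal (norm (f x))" M "\<lambda>x. ennreal (norm (g x))"]
    by (simp add: nn_integral_sqint f g)
  then have "ennreal (?I\<^sup>2) \<le> ennreal ((nrm2 M f * nrm2 M g)\<^sup>2)"
    by (simp add: ennreal_power ennreal_mult' power_mult_distrib)
  then have "?I\<^sup>2 \<le> (nrm2 M f * nrm2 M g)\<^sup>2"
    by simp
  then show ?thesis
    by (rule power2_le_imp_le) simp
qed

lemma sqint_norm_integral_le:
  assumes "f \<in> sqint M" "g \<in> sqint M"
  shows "norm (LINT x|M. f x * g x) \<le> nrm2 M f * nrm2 M g"
  using integral_norm_bound[of M "\<lambda>x. f x * g x"] sqint_Cauchy_Schwarz[OF assms] by linarith

lemma sqint_scale: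
  assumes "f \<in> sqint M" shows "(\<lambda>x. c * f x) \<in> sqint M"
  using assms by (auto simp: sqint_def norm_mult power_mult_distrib)

lemma nrm2_scale: "nrm2 M (\<lambda>y. c * f y) = norm c * nrm2 M f"
  by (simp add: nrm2_def norm_mult power_mult_distrib real_sqrt_mult)

lemma norm_add_power2_le: "(norm (a + b))\<^sup>2 \<le> 2 * (norm a)\<^sup>2 + 2 * (norm b)\<^sup>2"
  for a b :: "'b::real_normed_vector"
proof -
  have "(norm (a + b))\<^sup>2 \<le> (norm a + norm b)\<^sup>2"
    by (intro power_mono norm_triangle_ineq) auto
  also have "\<dots> \<le> 2 * (norm a)\<^sup>2 + 2 * (norm b)\<^sup>2"
    using sum_squares_bound[of "norm a" "norm b"] by (simp add: power2_sum)
  finally show ?thesis .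
qed

lemma sqint_add:
  assumes f: "f \<in> sqint M" and g: "g \<in> sqint M"
  shows "(\<lambda>x. f x + g x) \<in> sqint M"
proof -
  note [measurable] = assms[THEN sqint_measurable]
  have "integrable M (\<lambda>x. (norm (f x + g x))\<^sup>2)"
  proof (rule Bochner_Integration.integrable_bound)
    show "integrable M (\<lambda>x. 2 * (norm (f x))\<^sup>2 + 2 * (norm (g x))\<^sup>2)"
      by (intro Bochner_Integration.integrable_add integrable_mult_right sqint_integrable assms)
    show "AE x in M. norm ((norm (f x + g x))\<^sup>2) \<le> norm (2 * (norm (f x))\<^sup>2 + 2 * (norm (g x))\<^sup>2)"
      by (simp add: norm_add_power2_le)
  qed measurable
  then show ?thesis
    by (simp add: sqint_def)
qed

lemma sqint_diff:
  assumes "f \<in> sqint M" "g \<in> sqint M"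
  shows "(\<lambda>x. f x - g x) \<in> sqint M"
  using sqint_add[OF assms(1) sqint_scale[OF assms(2), of "-1"]] by simp

lemma sqint_cnj:
  assumes "f \<in> sqint M" shows "(\<lambda>x. cnj (f x)) \<in> sqint M"
proof -
  have "(\<lambda>x. cnj (f x)) \<in> borel_measurable M"
    by (rule borel_measurable_continuous_on[OF _ sqint_measurable[OF assms]])
      (intro continuous_intros)
  with assms show ?thesis by (simp add: sqint_def)
qed

lemma sqint_const: "finite_measure M \<Longrightarrow> (\<lambda>x. c) \<in> sqint M"
  by (simp add: sqint_def finite_measure.integrable_const)

lemma nrm2_const: "finite_measure M \<Longrightarrow> nrm2 M (\<lambda>x. 1) = sqrt (measure M (space M))"
  by (simp add: nrm2_def)

text \<open>By Tonelli the sum of the norms has finite integral, hence is finite almost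
  everywhere.\<close>

lemma AE_summable_norm:
  fixes f :: "nat \<Rightarrow> 'b \<Rightarrow> 'c::{banach, second_countable_topology}"
  assumes int: "\<And>i. integrable M (f i)"
    and sums: "summable (\<lambda>i. LINT x|M. norm (f i x))"
  shows "AE x in M. summable (\<lambda>i. norm (f i x))"
proof -
  note [measurable] = borel_measurable_integrable[OF int]
  have "(\<integral>\<^sup>+x. (\<Sum>i. ennreal (norm (f i x))) \<partial>M) = (\<Sum>i. \<integral>\<^sup>+x. ennreal (norm (f i x)) \<partial>M)"
    by (intro nn_integral_suminf) auto
  also have "\<dots> = (\<Sum>i. ennreal (LINT x|M. norm (f i x)))"
    by (intro arg_cong[where f=suminf] ext nn_integral_eq_integral integrable_norm int) auto
  also have "\<dots> \<noteq> \<infinity>"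
    unfolding infinity_ennreal_def by (rule ennreal_suminf_neq_top[OF sums]) simp
  finally have "AE x in M. (\<Sum>i. ennreal (norm (f i x))) \<noteq> \<infinity>"
    by (intro nn_integral_PInf_AE) auto
  then show ?thesis
    by eventually_elim (auto intro!: summable_suminf_not_top)
qed

text \<open>Riesz-Fischer. The geometric rate replaces the passage to a subsequence: on a finite
  measure space it makes the increments summable in L^1, so the sequence converges almost
  everywhere, and Fatou returns the same rate for the limit.\<close>

lemma sqint_complete:
  assumes fin: "finite_measure M"
    and f: "\<And>k. f k \<in> sqint M"
    and cauchy: "\<And>k l. k \<le> l \<Longrightarrow> nrm2 M (\<lambda>x. f l x - f k x) \<le> C * (1/2)^k"
  shows "\<exists>h\<in>sqint M. \<forall>k. nrm2 M (\<lambda>x. h x - f k x) \<le> C * (1/2)^k"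
proof -
  interpret finite_measure M by fact
  note [measurable] = sqint_measurable[OF f]
  have C: "0 \<le> C" using order_trans[OF nrm2_nonneg cauchy[of 0 0]] by simp
  define u where "u k x = f (Suc k) x - f k x" for k x
  have u: "u k \<in> sqint M" for k
    unfolding u_def by (intro sqint_diff f)
  have one: "(\<lambda>x. 1) \<in> sqint M"
    by (rule sqint_const[OF fin])
  have int: "integrable M (u k)" for k
    using sqint_mult_integrable[OF u one] by simp
  have "summable (\<lambda>k. LINT x|M. norm (u k x))"
  proof (rule summable_comparison_test')
    show "summable (\<lambda>k. C * nrm2 M (\<lambda>x. 1) * (1/2)^k)"
      by (intro summable_mult summable_geometric) simp
    fix k
    have "norm (LINT x|M. norm (u k x)) = (LINT x|M. norm (u k x * 1))"
      by simp
    also have "\<dots> \<le> nrm2 M (u k) * nrm2 M (\<lambda>x. 1)"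
      by (rule sqint_Cauchy_Schwarz[OF u one])
    also have "\<dots> \<le> (C * (1/2)^k) * nrm2 M (\<lambda>x. 1)"
      unfolding u_def by (intro mult_right_mono cauchy) auto
    finally show "norm (LINT x|M. norm (u k x)) \<le> C * nrm2 M (\<lambda>x. 1) * (1/2)^k"
      by (simp add: mult_ac)
  qed
  then have ae: "AE x in M. summable (\<lambda>k. norm (u k x))"
    by (intro AE_summable_norm int)
  \<comment> \<open>On the null set where the sequence diverges, \<open>lim\<close> takes an
    unspecified value; measurability holds regardless.\<close>
  define h where "h x = lim (\<lambda>k. f k x)" for x
  have h_meas [measurable]: "h \<in> borel_measurable M"
    unfolding h_def by (rule borel_measurable_lim_metric) measurable
  have lim: "AE x in M. (\<lambda>k. f k x) \<longlonglongrightarrow> h x"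
    using ae
  proof eventually_elim
    case (elim x)
    have "(\<lambda>n. f 0 x + (\<Sum>k<n. u k x)) \<longlonglongrightarrow> f 0 x + (\<Sum>k. u k x)"
      by (intro tendsto_add tendsto_const summable_LIMSEQ summable_norm_cancel[OF elim])
    moreover have "f 0 x + (\<Sum>k<n. u k x) = f n x" for n
      unfolding u_def by (subst sum_lessThan_telescope) simp
    ultimately have "(\<lambda>n. f n x) \<longlonglongrightarrow> f 0 x + (\<Sum>k. u k x)"
      by simp
    then show ?case
      unfolding h_def by (simp add: limI)
  qed
  \<comment> \<open>Fatou with \<open>k\<close> fixed and \<open>l\<close> tending to infinity, the
    integrand being rewritten as a lower limit.\<close>
  have bound: "(\<integral>\<^sup>+x. (ennreal (norm (h x - f k x)))\<^sup>2 \<partial>M) \<le> ennreal ((C * (1/2)^k)\<^sup>2)" for k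
  proof -
    have "(\<integral>\<^sup>+x. (ennreal (norm (h x - f k x)))\<^sup>2 \<partial>M) =
          (\<integral>\<^sup>+x. liminf (\<lambda>l. ennreal ((norm (f l x - f k x))\<^sup>2)) \<partial>M)"
    proof (rule nn_integral_cong_AE, use lim in eventually_elim)
      case (elim x)
      then have "(\<lambda>l. ennreal ((norm (f l x - f k x))\<^sup>2)) \<longlonglongrightarrow> ennreal ((norm (h x - f k x))\<^sup>2)"
        by (intro tendsto_intros)
      then show ?case
        by (simp only: ennreal_power norm_ge_zero lim_imp_Liminf[OF sequentially_bot])
    qed
    also have "\<dots> \<le> liminf (\<lambda>l. \<integral>\<^sup>+x. ennreal ((norm (f l x - f k x))\<^sup>2) \<partial>M)"
      by (rule nn_integral_liminf) measurable
    also have "\<dots> \<le> ennreal ((C * (1/2)^k)\<^sup>2)"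
    proof (rule Liminf_le)
      show "\<forall>\<^sub>F l in sequentially.
        (\<integral>\<^sup>+x. ennreal ((norm (f l x - f k x))\<^sup>2) \<partial>M) \<le> ennreal ((C * (1/2)^k)\<^sup>2)"
        using eventually_ge_at_top[of k]
      proof eventually_elim
        case (elim l)
        have "(\<integral>\<^sup>+x. ennreal ((norm (f l x - f k x))\<^sup>2) \<partial>M) = ennreal ((nrm2 M (\<lambda>x. f l x - f k x))\<^sup>2)"
          using nn_integral_sqint[OF sqint_diff[OF f f]] by (simp add: ennreal_power)
        also have "\<dots> \<le> ennreal ((C * (1/2)^k)\<^sup>2)"
          by (intro ennreal_leI power_mono cauchy elim) auto
        finally show ?case .
      qed
    qed auto
    finally show ?thesis .
  qed
  have nn: "0 \<le> C * (1/2)^k" for k :: nat using C by simp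
  have d: "(\<lambda>x. h x - f k x) \<in> borel_measurable M" for k by measurable
  \<comment> \<open>The bound controls differences only, so \<open>h\<close> is recovered by adding
    \<open>f 0\<close> back.\<close>
  have "(\<lambda>x. (h x - f 0 x) + f 0 x) \<in> sqint M"
    by (intro sqint_add f sqintI_nn_integral(1)[OF d bound nn])
  then have "h \<in> sqint M" by simp
  with sqintI_nn_integral(2)[OF d bound nn] show ?thesis
    by (intro bexI[of _ h] allI)
qed

theorem sqint_Riesz:
  assumes fin: "finite_measure M"
    and add: "\<And>f g. f \<in> sqint M \<Longrightarrow> g \<in> sqint M \<Longrightarrow> l (\<lambda>x. f x + g x) = l f + l g"
    and scale: "\<And>c f. f \<in> sqint M \<Longrightarrow> l (\<lambda>x. c * f x) = c * l f"
    and bound: "\<And>f. f \<in> sqint M \<Longrightarrow> norm (l f :: complex) \<le> K * nrm2 M f"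
  shows "\<exists>h\<in>sqint M. \<forall>f\<in>sqint M. l f = (LINT x|M. h x * f x)"
proof -
  txt \<open>The representing function is the conjugate of the minimiser of \<open>J\<close>, whose minimising sequences are
    Cauchy by the parallelogram law.\<close>
  define J where "J f = (nrm2 M f)\<^sup>2 - 2 * Re (l f)" for f
  define ip where "ip f g = Re (LINT x|M. f x * cnj (g x))" for f g
  have int: "integrable M (\<lambda>x. f x * cnj (g x))" if "f \<in> sqint M" "g \<in> sqint M" for f g
    by (intro sqint_mult_integrable sqint_cnj that)
  have lin: "(\<lambda>x. f x + of_real t * g x) \<in> sqint M" if "f \<in> sqint M" "g \<in> sqint M" for f g t
    by (intro sqint_add sqint_scale that)
  \<comment> \<open>Real \<open>t\<close> suffice: the variation determines \<open>Re (l g)\<close>,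
    and complex linearity supplies the imaginary part at the end.\<close>
  have J_expand: "J (\<lambda>x. f x + of_real t * g x) = J f + 2 * t * (ip f g - Re (l g)) + t\<^sup>2 * (nrm2 M g)\<^sup>2"
    if f: "f \<in> sqint M" and g: "g \<in> sqint M" for f g t
  proof -
    have "(norm (a + of_real t * b))\<^sup>2 = (norm a)\<^sup>2 + 2 * t * Re (a * cnj b) + t\<^sup>2 * (norm b)\<^sup>2" for a b :: complex
      unfolding cmod_power2 by (simp add: power2_eq_square algebra_simps)
    then have "(nrm2 M (\<lambda>x. f x + of_real t * g x))\<^sup>2 =
      (LINT x|M. (norm (f x))\<^sup>2 + 2 * t * Re (f x * cnj (g x)) + t\<^sup>2 * (norm (g x))\<^sup>2)"
      by (simp only: nrm2_power2)
    also have "\<dots> = (nrm2 M f)\<^sup>2 + 2 * t * ip f g + t\<^sup>2 * (nrm2 M g)\<^sup>2"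
      using sqint_integrable[OF f] sqint_integrable[OF g] int[OF f g] integral_Re[OF int[OF f g]]
      by (simp add: nrm2_power2 ip_def del: times_complex.simps)
    finally show ?thesis
      using add[OF f sqint_scale[OF g]] scale[OF g] by (simp add: J_def algebra_simps)
  qed
  \<comment> \<open>Completing the square in \<open>nrm2 M f - K\<close>.\<close>
  have J_lower: "- K\<^sup>2 \<le> J f" if "f \<in> sqint M" for f
  proof -
    have "Re (l f) \<le> K * nrm2 M f"
      using bound[OF that] complex_Re_le_cmod[of "l f"] by linarith
    moreover have "0 \<le> (nrm2 M f - K)\<^sup>2" by simp
    ultimately show ?thesis by (simp add: J_def power2_diff mult_ac)
  qed
  define m where "m = Inf (J ` sqint M)"
  have ne: "J ` sqint M \<noteq> {}"
    using sqint_const[OF fin] by blast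
  have bdd: "bdd_below (J ` sqint M)"
    using J_lower by (intro bdd_belowI2)
  have m_le: "m \<le> J f" if "f \<in> sqint M" for f
    unfolding m_def using bdd that by (intro cInf_lower) auto
  \<comment> \<open>The tolerance is the square of the rate \<open>(1/2)^k\<close> that
    \<open>sqint_complete\<close> expects.\<close>
  have "\<exists>f\<in>sqint M. J f < m + (1/4)^k" for k :: nat
    using cInf_lessD[OF ne, of "m + (1/4)^k"] by (auto simp: m_def)
  then obtain f where f: "\<And>k. f k \<in> sqint M" and Jf: "\<And>k. J (f k) < m + (1/4)^k"
    by metis
  have "nrm2 M (\<lambda>x. f l x - f k x) \<le> 2 * (1/2)^k" if "k \<le> l" for k l
  proof -
    \<comment> \<open>Parallelogram law about the midpoint \<open>p\<close>: \<open>f l\<close> and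
      \<open>f k\<close> are \<open>p\<close> plus and minus half of \<open>d\<close>, so the linear
      terms cancel, and \<open>J p\<close> is at least \<open>m\<close>.\<close>
    define p where "p x = f k x + of_real (1/2) * (f l x - f k x)" for x
    define d where "d x = f l x - f k x" for x
    have d: "d \<in> sqint M" unfolding d_def by (intro sqint_diff f)
    have p: "p \<in> sqint M" unfolding p_def by (intro lin sqint_diff f)
    have "f l = (\<lambda>x. p x + of_real (1/2) * d x)" "f k = (\<lambda>x. p x + of_real (-1/2) * d x)"
      by (auto simp: p_def d_def field_simps)
    then have "J (f l) + J (f k) = 2 * J p + (nrm2 M d)\<^sup>2 / 2"
      using J_expand[OF p d, of "1/2"] J_expand[OF p d, of "-1/2"] by (simp add: power2_eq_square field_simps)
    moreover have "(1/4::real)^l \<le> (1/4)^k"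
      using that by (intro power_decreasing) auto
    ultimately have "(nrm2 M d)\<^sup>2 \<le> 4 * (1/4)^k"
      using Jf[of l] Jf[of k] m_le[OF p] by linarith
    also have "\<dots> = (2 * (1/2)^k)\<^sup>2"
      by (simp add: power_mult_distrib flip: power_mult) (simp add: power_mult mult.commute[of k] power2_eq_square)
    finally show ?thesis
      unfolding d_def by (rule power2_le_imp_le) simp
  qed
  then have "\<exists>h\<in>sqint M. \<forall>k. nrm2 M (\<lambda>x. h x - f k x) \<le> 2 * (1/2)^k"
    by (intro sqint_complete fin f)
  then obtain h where h: "h \<in> sqint M" and hf: "\<And>k. nrm2 M (\<lambda>x. h x - f k x) \<le> 2 * (1/2)^k"
    by blast
  have Re_eq: "Re (l g) = ip h g" if g: "g \<in> sqint M" for g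
  proof -
    have lim: "(\<lambda>k. ip (f k) g) \<longlonglongrightarrow> ip h g"
    proof (rule LIM_zero_cancel, rule Lim_null_comparison)
      show "\<forall>\<^sub>F k in sequentially. norm (ip (f k) g - ip h g) \<le> 2 * (1/2)^k * nrm2 M g"
      proof (rule always_eventually, rule allI)
        fix k
        have "ip h g - ip (f k) g = Re (LINT x|M. (h x - f k x) * cnj (g x))"
          using int[OF h g] int[OF f g] by (simp add: ip_def algebra_simps)
        then have "norm (ip (f k) g - ip h g) \<le> norm (LINT x|M. (h x - f k x) * cnj (g x))"
          using abs_Re_le_cmod[of "LINT x|M. (h x - f k x) * cnj (g x)"] by (simp add: abs_minus_commute)
        also have "\<dots> \<le> nrm2 M (\<lambda>x. h x - f k x) * nrm2 M (\<lambda>x. cnj (g x))"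
          by (intro sqint_norm_integral_le sqint_diff sqint_cnj h f g)
        also have "\<dots> \<le> 2 * (1/2)^k * nrm2 M g"
          using mult_right_mono[OF hf[of k] nrm2_nonneg[of M g]] by (simp add: nrm2_def)
        finally show "norm (ip (f k) g - ip h g) \<le> 2 * (1/2)^k * nrm2 M g" .
      qed
      show "(\<lambda>k. 2 * (1/2)^k * nrm2 M g) \<longlonglongrightarrow> 0"
        by (intro tendsto_eq_intros) (auto intro!: LIMSEQ_realpow_zero)
    qed
    define \<alpha> where "\<alpha> = ip h g - Re (l g)"
    \<comment> \<open>Instead of showing that \<open>h\<close> minimises \<open>J\<close>, the value
      of \<open>J\<close> at \<open>f k\<close> plus \<open>t\<close> times \<open>g\<close> is
      compared with \<open>m\<close>; letting \<open>k\<close> tend to infinity gives the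
      variational inequality for \<open>h\<close> directly.\<close>
    have quad: "0 \<le> 2 * t * \<alpha> + t\<^sup>2 * (nrm2 M g)\<^sup>2" for t
    proof (rule LIMSEQ_le_const)
      have q: "(\<lambda>k. (1/4::real)^k) \<longlonglongrightarrow> 0"
        by (intro LIMSEQ_realpow_zero) auto
      show "(\<lambda>k. (1/4)^k + 2 * t * (ip (f k) g - Re (l g)) + t\<^sup>2 * (nrm2 M g)\<^sup>2) \<longlonglongrightarrow>
        2 * t * \<alpha> + t\<^sup>2 * (nrm2 M g)\<^sup>2"
        unfolding \<alpha>_def by (rule tendsto_eq_intros lim q refl)+ simp
      have "0 \<le> (1/4)^k + 2 * t * (ip (f k) g - Re (l g)) + t\<^sup>2 * (nrm2 M g)\<^sup>2" for k
        using m_le[OF lin[OF f g, of k t]] J_expand[OF f g, of k t] Jf[of k] by linarith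
      then show "\<exists>N. \<forall>n\<ge>N. 0 \<le> (1/4)^n + 2 * t * (ip (f n) g - Re (l g)) + t\<^sup>2 * (nrm2 M g)\<^sup>2"
        by blast
    qed
    \<comment> \<open>The added 1 keeps \<open>N\<close> positive when \<open>g\<close> has norm
      zero; the choice \<open>t = - \<alpha> / N\<close> then makes the quadratic expression at most
      \<open>- \<alpha>\<^sup>2 / N\<close>.\<close>
    define N where "N = (nrm2 M g)\<^sup>2 + 1"
    have N: "0 < N" by (simp add: N_def add_nonneg_pos)
    have "0 \<le> 2 * (- \<alpha> / N) * \<alpha> + (- \<alpha> / N)\<^sup>2 * N"
      using quad[of "- \<alpha> / N"] mult_left_mono[of "(nrm2 M g)\<^sup>2" N "(- \<alpha> / N)\<^sup>2"]
      by (simp add: N_def)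
    also have "\<dots> = - \<alpha>\<^sup>2 / N"
      using N by (simp add: field_simps power2_eq_square)
    finally have "\<alpha> = 0"
      using N by (simp add: field_simps)
    then show ?thesis by (simp add: \<alpha>_def)
  qed
  \<comment> \<open>The real part is known for all \<open>g\<close>; replacing \<open>g\<close> by
    \<open>- \<i> * g\<close> yields the imaginary part.\<close>
  have "l g = (LINT x|M. cnj (h x) * g x)" if g: "g \<in> sqint M" for g
  proof -
    have "(LINT x|M. h x * cnj (- \<i> * g x)) = (LINT x|M. \<i> * (h x * cnj (g x)))"
      by (intro Bochner_Integration.integral_cong) auto
    then have "ip h (\<lambda>x. - \<i> * g x) = - Im (LINT x|M. h x * cnj (g x))"
      by (simp add: ip_def)
    then have "l g = cnj (LINT x|M. h x * cnj (g x))"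
      using Re_eq[OF g] Re_eq[OF sqint_scale[OF g, of "- \<i>"]] scale[OF g, of "- \<i>"]
      by (simp add: ip_def complex_eq_iff)
    also have "\<dots> = (LINT x|M. cnj (h x) * g x)"
      using Bochner_Integration.integral_cnj[of M "\<lambda>x. h x * cnj (g x)"] by simp
    finally show ?thesis .
  qed
  then show ?thesis
    by (intro bexI[OF _ sqint_cnj[OF h]]) simp
qed

subsection \<open>Atoms and atomic decompositions\<close>

text \<open>Every free part is a member of \<open>D_components\<close>, so it equals the unique
  member \<open>C\<close>. If there is one, the Dirichlet part is disjoint from the nonempty set
  \<open>C\<close>, hence not \<open>C\<close>, hence empty, and \<open>C\<close> fills
  \<open>\<Omega>\<close>; without free parts the Dirichlet part is all of
  \<open>\<Omega>\<close>.\<close>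

lemma unique_D_component:
  assumes "\<exists>!C. C \<in> D_components \<Omega> D"
  shows "D_components \<Omega> D = {\<Omega>}"
proof -
  obtain C where C: "D_components \<Omega> D = {C}"
    using assms by auto
  have sub: "F \<subseteq> \<Omega>" "F \<noteq> {}" "F = C" if "F \<in> free_parts \<Omega> D" for F
  proof -
    show "F \<subseteq> \<Omega>" "F \<noteq> {}"
      using that in_components_subset in_components_nonempty by (auto simp: free_parts_def)
    then show "F = C"
      using that C by (auto simp: D_components_def)
  qed
  have "C = \<Omega>"
  proof (cases "free_parts \<Omega> D = {}")
    case True
    then show ?thesis
      using C by (auto simp: D_components_def dirichlet_part_def)
  next
    case False
    then have free: "free_parts \<Omega> D = {C}"
      using sub(3) by auto
    then have "dirichlet_part \<Omega> D \<noteq> C"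
      using sub(1,2) by (auto simp: dirichlet_part_def)
    then have "dirichlet_part \<Omega> D = {}"
      using C by (auto simp: D_components_def)
    then show ?thesis
      using sub(1) free by (auto simp: dirichlet_part_def)
  qed
  with C show ?thesis by simp
qed

section \<open>Extension by zero\<close>

definition zero_outside :: "'b set \<Rightarrow> ('b \<Rightarrow> complex) \<Rightarrow> 'b \<Rightarrow> complex" where
  "zero_outside S f x = (if x \<in> S then f x else 0)"

context
  fixes S T :: "'a::euclidean_space set"
  assumes S: "S \<in> sets lebesgue" and T: "T \<in> sets lebesgue" and ST: "S \<subseteq> T"
begin

lemma borel_measurable_zero_outside:
  "zero_outside S f \<in> borel_measurable (lebesgue_on T) \<longleftrightarrow> f \<in> borel_measurable (lebesgue_on S)"
  using borel_measurable_if_lebesgue_on[OF S T ST, of f] by (simp add: zero_outside_def[abs_def])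

lemma integral_zero_outside: "(LINT x|lebesgue_on T. zero_outside S f x) = (LINT x|lebesgue_on S. f x)"
  unfolding zero_outside_def by (rule integral_restrict[OF ST S T])

lemma integrable_if_zero_outside:
  fixes f :: "'a \<Rightarrow> 'c::{banach,second_countable_topology}"
  shows "integrable (lebesgue_on T) (\<lambda>x. if x \<in> S then f x else 0) \<longleftrightarrow> integrable (lebesgue_on S) f"
proof -
  have "(\<lambda>x. if x \<in> T then if x \<in> S then f x else 0 else 0) = (\<lambda>x. if x \<in> S then f x else 0)"
    using ST by (auto simp: fun_eq_iff)
  then show ?thesis
    using Lebesgue_Measure.integrable_restrict_UNIV[OF T, of "\<lambda>x. if x \<in> S then f x else 0"]
      Lebesgue_Measure.integrable_restrict_UNIV[OF S, of f] by simp
qed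

lemma sqint_zero_outside: "zero_outside S f \<in> sqint (lebesgue_on T) \<longleftrightarrow> f \<in> sqint (lebesgue_on S)"
proof -
  have "(\<lambda>x. (norm (zero_outside S f x))\<^sup>2) = (\<lambda>x. if x \<in> S then (norm (f x))\<^sup>2 else 0)"
    by (auto simp: zero_outside_def)
  then show ?thesis
    using integrable_if_zero_outside[of "\<lambda>x. (norm (f x))\<^sup>2"] by (simp add: sqint_def borel_measurable_zero_outside)
qed

lemma nrm2_zero_outside: "nrm2 (lebesgue_on T) (zero_outside S f) = nrm2 (lebesgue_on S) f"
proof -
  have "(\<lambda>x. (norm (zero_outside S f x))\<^sup>2) = (\<lambda>x. if x \<in> S then (norm (f x))\<^sup>2 else 0)"
    by (auto simp: zero_outside_def)
  then show ?thesis
    using integral_restrict[OF ST S T, of "\<lambda>x. (norm (f x))\<^sup>2"] by (simp add: nrm2_def)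
qed

lemma sqint_subset:
  assumes "f \<in> sqint (lebesgue_on T)" shows "f \<in> sqint (lebesgue_on S)"
proof -
  have f: "f \<in> borel_measurable (lebesgue_on S)"
    using sqint_measurable[OF assms] ST by (rule measurable_restrict_mono)
  then have c [measurable]: "zero_outside S f \<in> borel_measurable (lebesgue_on T)"
    by (simp add: borel_measurable_zero_outside)
  have "integrable (lebesgue_on T) (\<lambda>x. (norm (zero_outside S f x))\<^sup>2)"
  proof (rule Bochner_Integration.integrable_bound[OF sqint_integrable[OF assms]])
    show "(\<lambda>x. (norm (zero_outside S f x))\<^sup>2) \<in> borel_measurable (lebesgue_on T)"
      by measurable
  qed (auto simp: zero_outside_def)
  with c have "zero_outside S f \<in> sqint (lebesgue_on T)"
    by (simp add: sqint_def)
  then show ?thesis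
    by (simp add: sqint_zero_outside)
qed

lemma nrm2_subset_le:
  assumes "f \<in> sqint (lebesgue_on T)"
  shows "nrm2 (lebesgue_on S) f \<le> nrm2 (lebesgue_on T) f"
proof -
  have "zero_outside S f \<in> sqint (lebesgue_on T)"
    using sqint_subset[OF assms] by (simp add: sqint_zero_outside)
  then have "(LINT x|lebesgue_on T. (norm (zero_outside S f x))\<^sup>2) \<le> (LINT x|lebesgue_on T. (norm (f x))\<^sup>2)"
    by (rule Bochner_Integration.integral_mono[OF sqint_integrable sqint_integrable[OF assms]])
      (simp add: zero_outside_def)
  then have "nrm2 (lebesgue_on T) (zero_outside S f) \<le> nrm2 (lebesgue_on T) f"
    by (simp add: nrm2_def)
  then show ?thesis
    by (simp only: nrm2_zero_outside)
qed

lemma zero_outside_AE_eq: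
  assumes "AE x in lebesgue_on T. x \<notin> S \<longrightarrow> f x = 0"
  shows "AE x in lebesgue_on T. zero_outside S f x = f x"
  using assms by eventually_elim (auto simp: zero_outside_def)

text \<open>Almost everywhere on \<open>T\<close> the product is the zero extension of a product on
  \<open>S\<close>, so square integrability of \<open>g\<close> matters only where \<open>f\<close>
  lives. This lets locally square-integrable functions be paired with functions of bounded
  support.\<close>

lemma integral_pairing:
  assumes g: "g \<in> borel_measurable (lebesgue_on T)" "g \<in> sqint (lebesgue_on S)"
    and f: "f \<in> sqint (lebesgue_on T)" "AE x in lebesgue_on T. x \<notin> S \<longrightarrow> f x = 0"
  shows "integrable (lebesgue_on T) (\<lambda>x. g x * f x)"
    and "(LINT x|lebesgue_on T. g x * f x) = (LINT x|lebesgue_on S. g x * f x)"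
proof -
  note [measurable] = g(1) sqint_measurable[OF f(1)]
  have "zero_outside S (\<lambda>x. g x * f x) \<in> borel_measurable (lebesgue_on T)"
    using sqint_measurable[OF g(2)] sqint_measurable[OF sqint_subset[OF f(1)]]
    by (simp add: borel_measurable_zero_outside)
  note m = this
  have ae: "AE x in lebesgue_on T. zero_outside S (\<lambda>x. g x * f x) x = g x * f x"
    using f(2) by (intro zero_outside_AE_eq) auto
  have "integrable (lebesgue_on T) (zero_outside S (\<lambda>x. g x * f x))"
    unfolding zero_outside_def[abs_def] integrable_if_zero_outside
    by (intro sqint_mult_integrable g sqint_subset f)
  then show "integrable (lebesgue_on T) (\<lambda>x. g x * f x)"
    by (rule integrable_cong_AE_imp) (use ae in auto)
  have "(LINT x|lebesgue_on T. g x * f x) = (LINT x|lebesgue_on T. zero_outside S (\<lambda>x. g x * f x) x)"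
    using m ae by (intro integral_cong_AE) auto
  then show "(LINT x|lebesgue_on T. g x * f x) = (LINT x|lebesgue_on S. g x * f x)"
    by (simp add: integral_zero_outside)
qed

end

section \<open>Domination and truncation of complex values\<close>

lemma sqint_dominated:
  assumes "f \<in> borel_measurable M" "g \<in> sqint M" "\<And>x. norm (f x) \<le> norm (g x)"
  shows "f \<in> sqint M" and "nrm2 M f \<le> nrm2 M g"
proof -
  have le: "(norm (f x))\<^sup>2 \<le> (norm (g x))\<^sup>2" for x
    using assms(3) by (intro power_mono) auto
  have "integrable M (\<lambda>x. (norm (f x))\<^sup>2)"
    by (rule Bochner_Integration.integrable_bound[OF sqint_integrable[OF assms(2)]])
      (use assms(1) le in auto)
  then show f: "f \<in> sqint M"
    using assms(1) by (simp add: sqint_def)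
  have "(LINT x|M. (norm (f x))\<^sup>2) \<le> (LINT x|M. (norm (g x))\<^sup>2)"
    by (rule Bochner_Integration.integral_mono[OF sqint_integrable[OF f] sqint_integrable[OF assms(2)] le])
  then show "nrm2 M f \<le> nrm2 M g"
    by (simp add: nrm2_def)
qed

text \<open>The radial truncation, taken as a nearest-point map because such maps onto closed convex
  sets are 1-Lipschitz. For negative \<open>N\<close> the disc is empty, which is why
  \<open>0 \<le> N\<close> accompanies most facts about it.\<close>

definition clip :: "real \<Rightarrow> complex \<Rightarrow> complex" where
  "clip N = closest_point (cball 0 N)"

lemma norm_clip_diff_le: "0 \<le> N \<Longrightarrow> norm (clip N z - clip N w) \<le> norm (z - w)"
  using closest_point_lipschitz[of "cball 0 N" z w] by (simp add: clip_def dist_norm)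

lemma clip_self: "norm z \<le> N \<Longrightarrow> clip N z = z"
  by (simp add: clip_def closest_point_self)

lemma norm_clip_le: "0 \<le> N \<Longrightarrow> norm (clip N z) \<le> norm z"
  using norm_clip_diff_le[of N z 0] clip_self[of 0 N] by simp

lemma norm_clip_bound: "0 \<le> N \<Longrightarrow> norm (clip N z) \<le> N"
  using closest_point_in_set[of "cball 0 N" z] by (simp add: clip_def)

lemma borel_measurable_clip [measurable]: "0 \<le> N \<Longrightarrow> clip N \<in> borel_measurable borel"
  unfolding clip_def by (intro borel_measurable_continuous_onI continuous_on_closest_point) auto

lemma clip_tendsto: "(\<lambda>n. clip (real n) z) \<longlonglongrightarrow> z"
proof (rule tendsto_eventually)
  obtain n where "norm z \<le> real n"
    using real_arch_simple by blast
  then show "\<forall>\<^sub>F n in sequentially. clip (real n) z = z"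
    by (intro eventually_sequentiallyI[of n] clip_self) linarith
qed

section \<open>Balls, test functions and atoms of a single component\<close>

locale one_component =
  fixes \<Omega> D :: "'a::euclidean_space set"
  assumes open_domain: "open \<Omega>" and nonempty: "\<Omega> \<noteq> {}"
    and components: "D_components \<Omega> D = {\<Omega>}"
begin

abbreviation dball :: "'a \<Rightarrow> real \<Rightarrow> 'a set" where
  "dball x r \<equiv> ball x r \<inter> \<Omega>"

definition near :: "'a \<Rightarrow> real \<Rightarrow> bool" where
  "near x r \<longleftrightarrow> ball x (2 * r) \<inter> (D \<inter> frontier \<Omega>) \<noteq> {}"

text \<open>Up to scaling, the atoms belonging to the ball \<open>dball x r\<close>.\<close>

definition test :: "'a \<Rightarrow> real \<Rightarrow> ('a \<Rightarrow> complex) \<Rightarrow> bool" where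
  "test x r f \<longleftrightarrow> f \<in> sqint (lebesgue_on \<Omega>) \<and> (AE y in lebesgue_on \<Omega>. y \<notin> dball x r \<longrightarrow> f y = 0) \<and>
     ((LINT y|lebesgue_on \<Omega>. f y) = 0 \<or> near x r)"

lemma usual_balls_eq: "usual_balls \<Omega> D = {(\<Omega>, x, r) |x r. x \<in> \<Omega> \<and> r > 0}"
  by (auto simp: usual_balls_def components)

lemma near_balls_eq: "near_balls \<Omega> D = {(\<Omega>, x, r) |x r. x \<in> \<Omega> \<and> r > 0 \<and> near x r}"
  by (auto simp: near_balls_def usual_balls_eq near_def)

lemma sets_domain [simp, intro]: "\<Omega> \<in> sets lebesgue"
  using open_domain by simp

lemma sets_dball [simp, intro]: "dball x r \<in> sets lebesgue"
  using open_domain by simp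

lemma dball_lmeasurable [simp, intro]: "dball x r \<in> lmeasurable"
  using open_domain by (intro lmeasurable_open) (auto intro: bounded_subset[OF bounded_ball])

lemma measure_dball_pos:
  assumes "x \<in> \<Omega>" "0 < r" shows "0 < measure lebesgue (dball x r)"
proof -
  have "x \<in> dball x r" using assms by simp
  then have "\<not> negligible (dball x r)"
    using open_domain by (intro open_not_negligible) blast+
  then show ?thesis
    using negligible_iff_measure0[OF dball_lmeasurable] by (simp add: zero_less_measure_iff)
qed

lemma finite_measure_dball: "finite_measure (lebesgue_on (dball x r))"
  by (intro finite_measure_lebesgue_on) simp

lemma AE_domain_iff: "(AE x in lebesgue_on \<Omega>. P x) \<longleftrightarrow> (AE x in lebesgue. x \<in> \<Omega> \<longrightarrow> P x)"
  by (simp add: AE_restrict_space_iff)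

text \<open>Passing from the pointwise support to an almost-everywhere statement uses Lindelof:
  countably many open sets on which \<open>a\<close> vanishes almost everywhere cover the part of
  \<open>\<Omega>\<close> off the support. The converse uses one open set, the complement of the
  closure.\<close>

lemma ess_support_iff:
  "ess_support \<Omega> a \<subseteq> closure (dball x r) \<longleftrightarrow> (AE y in lebesgue_on \<Omega>. y \<notin> dball x r \<longrightarrow> a y = 0)"
proof
  assume sub: "ess_support \<Omega> a \<subseteq> closure (dball x r)"
  define \<U> where "\<U> = {U. open U \<and> (AE y in lebesgue_on (\<Omega> \<inter> U). a y = 0)}"
  obtain \<V> where \<V>: "\<V> \<subseteq> \<U>" "countable \<V>" "\<Union>\<V> = \<Union>\<U>"
    by (rule Lindelof[of \<U>]) (auto simp: \<U>_def)
  have "\<forall>U\<in>\<V>. AE y in lebesgue. y \<in> \<Omega> \<inter> U \<longrightarrow> a y = 0"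
  proof
    fix U assume "U \<in> \<V>"
    then have "open U" and U: "AE y in lebesgue_on (\<Omega> \<inter> U). a y = 0"
      using \<V>(1) by (auto simp: \<U>_def)
    then have "\<Omega> \<inter> U \<in> sets lebesgue"
      using open_domain by simp
    then show "AE y in lebesgue. y \<in> \<Omega> \<inter> U \<longrightarrow> a y = 0"
      using U by (simp add: AE_restrict_space_iff)
  qed
  then have "AE y in lebesgue. \<forall>U\<in>\<V>. y \<in> \<Omega> \<inter> U \<longrightarrow> a y = 0"
    by (simp only: AE_ball_countable[OF \<V>(2)])
  \<comment> \<open>Points of \<open>\<Omega>\<close> in \<open>closure (dball x r)\<close> but
    outside \<open>dball x r\<close> lie on the sphere, which is null.\<close>
  moreover have "AE y in lebesgue. y \<notin> sphere x r"
    by (rule AE_not_in) (simp add: negligible_sphere flip: negligible_iff_null_sets)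
  ultimately have "AE y in lebesgue. y \<in> \<Omega> \<longrightarrow> y \<notin> dball x r \<longrightarrow> a y = 0"
  proof eventually_elim
    case (elim y)
    show ?case
    proof (intro impI)
      assume y: "y \<in> \<Omega>" "y \<notin> dball x r"
      have "y \<notin> cball x r"
        using y elim(2) by (auto simp: sphere_def)
      moreover have "closure (dball x r) \<subseteq> cball x r"
        by (rule closure_minimal) auto
      ultimately have "y \<notin> ess_support \<Omega> a"
        using sub by auto
      then have "y \<in> \<Union>\<U>"
        using y(1) by (auto simp: ess_support_def \<U>_def)
      then show "a y = 0"
        using elim(1) y(1) \<V>(3) by auto
    qed
  qed
  then show "AE y in lebesgue_on \<Omega>. y \<notin> dball x r \<longrightarrow> a y = 0"
    by (simp add: AE_domain_iff)
next
  assume ae: "AE y in lebesgue_on \<Omega>. y \<notin> dball x r \<longrightarrow> a y = 0"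
  have "AE y in lebesgue_on (\<Omega> \<inter> - closure (dball x r)). a y = 0"
  proof -
    have "\<Omega> \<inter> - closure (dball x r) \<in> sets lebesgue"
      using open_domain by (intro sets.Int) auto
    moreover have "AE y in lebesgue. y \<in> \<Omega> \<inter> - closure (dball x r) \<longrightarrow> a y = 0"
      using ae unfolding AE_domain_iff
      by eventually_elim (meson ComplD IntE closure_subset subsetD)
    ultimately show ?thesis
      by (simp add: AE_restrict_space_iff)
  qed
  then have "\<And>y. y \<in> \<Omega> \<Longrightarrow> y \<notin> closure (dball x r) \<Longrightarrow> y \<notin> ess_support \<Omega> a"
    unfolding ess_support_def by (auto intro!: exI[of _ "- closure (dball x r)"])
  then show "ess_support \<Omega> a \<subseteq> closure (dball x r)"
    by (auto simp: ess_support_def)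
qed

text \<open>Multiplying out the negative power of the measure turns the size condition into a bound
  on the product that controls both the L^1 norm of \<open>a\<close> and its pairing with functions
  of bounded oscillation.\<close>

lemma H1_atom_iff:
  "H1_atom \<Omega> D a \<longleftrightarrow> (\<exists>x r. x \<in> \<Omega> \<and> 0 < r \<and> test x r a \<and>
     nrm2 (lebesgue_on \<Omega>) a * sqrt (measure lebesgue (dball x r)) \<le> 1)"
proof -
  have eq: "sqrt (LINT y|lebesgue_on \<Omega>. (norm (a y))\<^sup>2) \<le> measure lebesgue (dball x r) powr (-1/2) \<longleftrightarrow>
      nrm2 (lebesgue_on \<Omega>) a * sqrt (measure lebesgue (dball x r)) \<le> 1"
    if "x \<in> \<Omega>" "0 < r" for x r
  proof -
    have "measure lebesgue (dball x r) powr (-1/2) = 1 / sqrt (measure lebesgue (dball x r))"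
      using measure_dball_pos[OF that] by (simp add: powr_minus_divide powr_half_sqrt)
    then show ?thesis
      unfolding nrm2_def using measure_dball_pos[OF that] by (simp only: pos_le_divide_eq real_sqrt_gt_0_iff)
  qed
  have "H1_atom \<Omega> D a \<longleftrightarrow> a \<in> borel_measurable (lebesgue_on \<Omega>) \<and>
     (\<exists>x r. x \<in> \<Omega> \<and> 0 < r \<and> ess_support \<Omega> a \<subseteq> closure (dball x r) \<and>
        integrable (lebesgue_on \<Omega>) (\<lambda>x. (norm (a x))\<^sup>2) \<and>
        sqrt (LINT x|lebesgue_on \<Omega>. (norm (a x))\<^sup>2) \<le> measure lebesgue (dball x r) powr (-1/2) \<and>
        ((LINT x|lebesgue_on \<Omega>. a x) = 0 \<or> near x r))"
    unfolding H1_atom_def usual_balls_eq near_balls_eq by (auto; fastforce)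
  also have "\<dots> \<longleftrightarrow> (\<exists>x r. x \<in> \<Omega> \<and> 0 < r \<and> test x r a \<and>
      sqrt (LINT x|lebesgue_on \<Omega>. (norm (a x))\<^sup>2) \<le> measure lebesgue (dball x r) powr (-1/2))"
    unfolding ess_support_iff test_def sqint_def mem_Collect_eq by blast
  also have "\<dots> \<longleftrightarrow> (\<exists>x r. x \<in> \<Omega> \<and> 0 < r \<and> test x r a \<and>
     nrm2 (lebesgue_on \<Omega>) a * sqrt (measure lebesgue (dball x r)) \<le> 1)"
    by (simp only: eq cong: conj_cong)
  finally show ?thesis .
qed

text \<open>Cauchy-Schwarz against the constant 1 on the ball. It makes the L^1 norm of every atom
  at most 1.\<close>

lemma test_integral:
  assumes "test x r f"
  shows "integrable (lebesgue_on \<Omega>) f"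
    and "(LINT y|lebesgue_on \<Omega>. norm (f y)) \<le> nrm2 (lebesgue_on \<Omega>) f * sqrt (measure lebesgue (dball x r))"
proof -
  let ?S = "dball x r"
  have f: "f \<in> sqint (lebesgue_on \<Omega>)" and ae: "AE y in lebesgue_on \<Omega>. y \<notin> ?S \<longrightarrow> f y = 0"
    using assms by (auto simp: test_def)
  have one: "(\<lambda>y. 1) \<in> sqint (lebesgue_on ?S)"
    by (intro sqint_const finite_measure_dball)
  show int: "integrable (lebesgue_on \<Omega>) f"
    using integral_pairing(1)[OF _ _ _ _ one f ae] by simp
  have fS: "f \<in> sqint (lebesgue_on ?S)"
    by (rule sqint_subset[OF _ _ _ f]) auto
  \<comment> \<open>\<open>integral_pairing\<close> speaks of complex functions, so the modulus is
    passed through it as a complex-valued function.\<close>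
  have "(\<lambda>y. complex_of_real (norm (f y))) \<in> sqint (lebesgue_on \<Omega>)"
    using f by (auto simp: sqint_def)
  from integral_pairing(2)[OF _ _ _ _ one this]
  have "(LINT y|lebesgue_on \<Omega>. complex_of_real (norm (f y))) = (LINT y|lebesgue_on ?S. complex_of_real (norm (f y)))"
    using ae by simp
  then have "(LINT y|lebesgue_on \<Omega>. norm (f y)) = (LINT y|lebesgue_on ?S. norm (f y * 1))"
    by simp
  also have "\<dots> \<le> nrm2 (lebesgue_on ?S) f * nrm2 (lebesgue_on ?S) (\<lambda>y. 1)"
    by (rule sqint_Cauchy_Schwarz[OF fS one])
  also have "\<dots> \<le> nrm2 (lebesgue_on \<Omega>) f * sqrt (measure lebesgue ?S)"
    using nrm2_subset_le[OF _ _ _ f, of ?S]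
    by (auto simp: nrm2_const finite_measure_dball measure_restrict_space intro!: mult_right_mono)
  finally show "(LINT y|lebesgue_on \<Omega>. norm (f y)) \<le> nrm2 (lebesgue_on \<Omega>) f * sqrt (measure lebesgue ?S)" .
qed

lemma atom_integrable: "H1_atom \<Omega> D a \<Longrightarrow> integrable (lebesgue_on \<Omega>) a"
  and atom_integral_le: "H1_atom \<Omega> D a \<Longrightarrow> (LINT y|lebesgue_on \<Omega>. norm (a y)) \<le> 1"
  unfolding H1_atom_iff using test_integral by fastforce+

lemma test_scale:
  assumes "test x r f" shows "test x r (\<lambda>y. c * f y)"
  using assms by (auto simp: test_def sqint_scale)

text \<open>Any positive upper bound \<open>\<kappa>\<close> may serve as divisor; the exact value
  would be zero for a null function.\<close>

lemma test_atom:
  assumes "x \<in> \<Omega>" "0 < r" "test x r f" "0 < \<kappa>"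
    and "nrm2 (lebesgue_on \<Omega>) f * sqrt (measure lebesgue (dball x r)) \<le> \<kappa>"
  shows "H1_atom \<Omega> D (\<lambda>y. of_real (1/\<kappa>) * f y)"
  unfolding H1_atom_iff
  using assms by (intro exI[of _ x] exI[of _ r] conjI test_scale)
    (auto simp only: nrm2_scale norm_of_real, auto simp: field_simps)

text \<open>Fills up finite combinations to sequences of atoms.\<close>

lemma zero_atom: "H1_atom \<Omega> D (\<lambda>y. 0)"
proof -
  obtain x where "x \<in> \<Omega>" using nonempty by auto
  then show ?thesis
    unfolding H1_atom_iff by (auto intro!: exI[of _ x] exI[of _ 1] simp: test_def sqint_def nrm2_def)
qed

lemma atomic_decomp_finite:
  assumes "\<And>j. j < n \<Longrightarrow> H1_atom \<Omega> D (a j)"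
    and f: "AE x in lebesgue_on \<Omega>. f x = (\<Sum>j<n. l j * a j x)"
  shows "atomic_decomp \<Omega> D f (\<lambda>j. if j < n then l j else 0) (\<lambda>j. if j < n then a j else (\<lambda>_. 0))"
proof -
  have "(\<lambda>j. norm (if j < n then l j else 0)) sums (\<Sum>j<n. norm (l j))"
    using sums_If_finite_set[of "{..<n}" "\<lambda>j. norm (l j)"] by (simp add: if_distrib cong: if_cong)
  moreover have "(\<lambda>j. (if j < n then l j else 0) * (if j < n then a j else (\<lambda>_. 0)) x) sums (\<Sum>j<n. l j * a j x)" for x
  proof -
    have "(\<lambda>j. (if j < n then l j else 0) * (if j < n then a j else (\<lambda>_. 0)) x) =
      (\<lambda>j. if j \<in> {..<n} then l j * a j x else 0)" by auto
    then show ?thesis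
      using sums_If_finite_set[of "{..<n}" "\<lambda>j. l j * a j x"] by simp
  qed
  ultimately show ?thesis
    using assms(1) zero_atom f unfolding atomic_decomp_def by (auto simp: sums_iff)
qed

section \<open>The atomic norm and finite combinations of atoms\<close>

lemma H1_norm_le: "atomic_decomp \<Omega> D f l a \<Longrightarrow> H1_norm \<Omega> D f \<le> (\<Sum>j. norm (l j))"
  unfolding H1_norm_def
  by (rule cInf_lower) (auto intro!: bdd_belowI[of _ 0] suminf_nonneg simp: atomic_decomp_def)

lemma H1_norm_less_decomp:
  assumes "f \<in> H1 \<Omega> D" "H1_norm \<Omega> D f < e"
  obtains l a where "atomic_decomp \<Omega> D f l a" "(\<Sum>j. norm (l j)) < e"
proof -
  have "{(\<Sum>j. norm (l j)) | l a. atomic_decomp \<Omega> D f l a} \<noteq> {}"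
    using assms(1) by (auto simp: H1_def)
  from cInf_lessD[OF this] assms(2) show ?thesis
    unfolding H1_norm_def using that by blast
qed

lemma H1_norm_nonneg:
  assumes "f \<in> H1 \<Omega> D" shows "0 \<le> H1_norm \<Omega> D f"
proof (rule ccontr)
  assume "\<not> ?thesis"
  then obtain l a where "atomic_decomp \<Omega> D f l a" "(\<Sum>j. norm (l j)) < 0"
    using H1_norm_less_decomp[OF assms, of 0] by auto
  then show False
    using suminf_nonneg[of "\<lambda>j. norm (l j)"] by (auto simp: atomic_decomp_def)
qed

lemma atom_H1_fin:
  assumes "H1_atom \<Omega> D a" shows "(\<lambda>x. c * a x) \<in> H1_fin \<Omega> D"
  unfolding H1_fin_def using assms
  by (auto intro!: exI[of _ "Suc 0"] exI[of _ "\<lambda>_. c"] exI[of _ "\<lambda>_. a"])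

lemma sum_atoms_H1_fin:
  fixes n :: nat
  assumes "\<And>j. j < n \<Longrightarrow> H1_atom \<Omega> D (a j)" shows "(\<lambda>x. \<Sum>j<n. l j * a j x) \<in> H1_fin \<Omega> D"
  unfolding H1_fin_def
  by (rule CollectI, rule exI[of _ n], rule exI[of _ l], rule exI[of _ a]) (use assms in simp)

lemma H1_fin_subset: "H1_fin \<Omega> D \<subseteq> H1 \<Omega> D"
proof
  fix f assume "f \<in> H1_fin \<Omega> D"
  then obtain n :: nat and l a where "\<forall>j<n. H1_atom \<Omega> D (a j)" "AE x in lebesgue_on \<Omega>. f x = (\<Sum>j<n. l j * a j x)"
    unfolding H1_fin_def by blast
  then show "f \<in> H1 \<Omega> D"
    unfolding H1_def using atomic_decomp_finite by blast
qed

lemma H1_norm_atom_le: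
  assumes "H1_atom \<Omega> D a" shows "H1_norm \<Omega> D a \<le> 1"
proof -
  have "(\<lambda>j. norm (if j < Suc 0 then 1 else 0 :: complex)) sums (\<Sum>j<Suc 0. 1)"
    using sums_If_finite_set[of "{..<Suc 0}" "\<lambda>j. 1::real"] by (simp add: if_distrib cong: if_cong)
  then show ?thesis
    using H1_norm_le[OF atomic_decomp_finite[of "Suc 0" "\<lambda>_. a" a "\<lambda>_. 1"]] assms
    by (simp add: sums_iff del: less_Suc0)
qed

lemma L2_mean_le_iff:
  assumes "x \<in> \<Omega>" "0 < r"
  shows "L2_mean (dball x r) f \<le> M \<longleftrightarrow>
    nrm2 (lebesgue_on (dball x r)) f \<le> M * sqrt (measure lebesgue (dball x r))"
  using measure_dball_pos[OF assms]
  by (simp add: L2_mean_def nrm2_def real_sqrt_mult real_sqrt_divide field_simps)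

subsection \<open>The functional of a BMO function\<close>

text \<open>Lebesgue measure on the whole space is complete, and the zero extension carries this
  over to \<open>\<Omega>\<close>. It applies to atomic decompositions, whose sums are given only
  almost everywhere.\<close>

lemma borel_measurable_AE_domain:
  fixes f g :: "'a \<Rightarrow> complex"
  assumes f: "f \<in> borel_measurable (lebesgue_on \<Omega>)" and ae: "AE x in lebesgue_on \<Omega>. f x = g x"
  shows "g \<in> borel_measurable (lebesgue_on \<Omega>)"
proof -
  have "zero_outside \<Omega> f \<in> borel_measurable lebesgue"
    using f borel_measurable_zero_outside[of \<Omega> UNIV f] by (simp add: lebesgue_on_UNIV_eq)
  moreover have "AE x in lebesgue. zero_outside \<Omega> f x = zero_outside \<Omega> g x"
    using ae unfolding AE_domain_iff by eventually_elim (auto simp: zero_outside_def)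
  ultimately have "zero_outside \<Omega> g \<in> borel_measurable lebesgue"
    by (rule borel_measurable_AE)
  then show ?thesis
    using borel_measurable_zero_outside[of \<Omega> UNIV g] by (simp add: lebesgue_on_UNIV_eq)
qed

text \<open>Allowing any constant \<open>c\<close> in place of the mean makes this condition stable under contractions.\<close>

definition osc_bound :: "('a \<Rightarrow> complex) \<Rightarrow> real \<Rightarrow> bool" where
  "osc_bound g M \<longleftrightarrow> g \<in> borel_measurable (lebesgue_on \<Omega>) \<and>
     (\<forall>x\<in>\<Omega>. \<forall>r>0. g \<in> sqint (lebesgue_on (dball x r)) \<and>
       (\<exists>c. (near x r \<longrightarrow> c = 0) \<and>
          nrm2 (lebesgue_on (dball x r)) (\<lambda>y. g y - c) \<le> M * sqrt (measure lebesgue (dball x r))))"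

lemma BMO_sqint:
  assumes "g \<in> BMO \<Omega> D"
  shows "g \<in> borel_measurable (lebesgue_on \<Omega>)" and "g \<in> sqint (lebesgue_on (dball x r))"
proof -
  show g: "g \<in> borel_measurable (lebesgue_on \<Omega>)"
    using assms by (simp add: BMO_def)
  have "g \<in> borel_measurable (lebesgue_on (dball x r))"
    by (rule measurable_restrict_mono[OF g]) auto
  moreover have "bounded (dball x r)"
    by (rule bounded_subset[OF bounded_ball]) auto
  then have "integrable (lebesgue_on (dball x r)) (\<lambda>x. (norm (g x))\<^sup>2)"
    using assms sets_dball[of x r] unfolding BMO_def by blast
  ultimately show "g \<in> sqint (lebesgue_on (dball x r))"
    by (simp add: sqint_def)
qed

text \<open>On near balls the second supremum allows \<open>c = 0\<close>, on the others the first
  allows the mean. \<open>enn2real\<close> loses nothing, since the seminorm is finite on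
  \<open>BMO\<close>.\<close>

lemma BMO_osc_bound:
  assumes g: "g \<in> BMO \<Omega> D"
  shows "osc_bound g (enn2real (BMO_seminorm \<Omega> D g))"
proof -
  let ?M = "enn2real (BMO_seminorm \<Omega> D g)"
  have M: "ennreal ?M = BMO_seminorm \<Omega> D g"
    using g by (simp add: BMO_def)
  have "\<exists>c. (near x r \<longrightarrow> c = 0) \<and>
          nrm2 (lebesgue_on (dball x r)) (\<lambda>y. g y - c) \<le> ?M * sqrt (measure lebesgue (dball x r))"
    if x: "x \<in> \<Omega>" and r: "0 < r" for x r
  proof (cases "near x r")
    case True
    then have "(\<Omega>, x, r) \<in> near_balls \<Omega> D"
      using x r by (simp add: near_balls_eq)
    then have "ennreal (L2_mean (ball_set (\<Omega>, x, r)) g) \<le> BMO_seminorm \<Omega> D g"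
      unfolding BMO_seminorm_def by (intro max.coboundedI2 SUP_upper)
    then have "L2_mean (dball x r) g \<le> ?M"
      by (subst (asm) M[symmetric]) simp
    then show ?thesis
      unfolding L2_mean_le_iff[OF x r] by (intro exI[of _ 0]) simp
  next
    case False
    have "(\<Omega>, x, r) \<in> usual_balls \<Omega> D"
      using x r by (simp add: usual_balls_eq)
    then have "ennreal (L2_mean (ball_set (\<Omega>, x, r)) (\<lambda>y. g y - mean (ball_set (\<Omega>, x, r)) g)) \<le>
        BMO_seminorm \<Omega> D g"
      unfolding BMO_seminorm_def by (intro max.coboundedI1 SUP_upper)
    then have "L2_mean (dball x r) (\<lambda>y. g y - mean (dball x r) g) \<le> ?M"
      by (subst (asm) M[symmetric]) simp
    then show ?thesis
      unfolding L2_mean_le_iff[OF x r] using False by blast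
  qed
  then show ?thesis
    unfolding osc_bound_def using BMO_sqint[OF g] by blast
qed

lemma osc_bound_nonneg:
  assumes "osc_bound g M" shows "0 \<le> M"
proof -
  obtain x where x: "x \<in> \<Omega>" using nonempty by auto
  then obtain c where "nrm2 (lebesgue_on (dball x 1)) (\<lambda>y. g y - c) \<le> M * sqrt (measure lebesgue (dball x 1))"
    using assms unfolding osc_bound_def by (metis zero_less_one)
  then have "0 \<le> M * sqrt (measure lebesgue (dball x 1))"
    using nrm2_nonneg order_trans by blast
  then show ?thesis
    using measure_dball_pos[OF x, of 1] by (simp add: zero_le_mult_iff)
qed

text \<open>The constant \<open>c\<close> is replaced by \<open>clip N c\<close>, so the contraction
  property applies pointwise; \<open>clip\<close> fixes \<open>0\<close>, which keeps the condition
  on near balls. The mean of \<open>g\<close> is in general not sent to the mean of the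
  truncation.\<close>

lemma osc_bound_clip:
  assumes g: "osc_bound g M" and N: "0 \<le> N"
  shows "osc_bound (\<lambda>x. clip N (g x)) M"
  unfolding osc_bound_def
proof (intro conjI ballI allI impI)
  have "g \<in> borel_measurable (lebesgue_on \<Omega>)"
    using g by (simp add: osc_bound_def)
  then show gm: "(\<lambda>x. clip N (g x)) \<in> borel_measurable (lebesgue_on \<Omega>)"
    by (rule measurable_compose[OF _ borel_measurable_clip[OF N]])
  fix x r assume x: "x \<in> \<Omega>" "0 < (r::real)"
  let ?L = "lebesgue_on (dball x r)"
  obtain c where gs: "g \<in> sqint ?L" and c: "near x r \<longrightarrow> c = 0"
      "nrm2 ?L (\<lambda>y. g y - c) \<le> M * sqrt (measure lebesgue (dball x r))"
    using g x unfolding osc_bound_def by meson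
  have m: "(\<lambda>x. clip N (g x)) \<in> borel_measurable ?L"
    by (rule measurable_restrict_mono[OF gm]) auto
  show "(\<lambda>x. clip N (g x)) \<in> sqint ?L"
    by (rule sqint_dominated(1)[OF m gs norm_clip_le[OF N]])
  have "nrm2 ?L (\<lambda>y. clip N (g y) - clip N c) \<le> nrm2 ?L (\<lambda>y. g y - c)"
    by (rule sqint_dominated(2)[OF _ sqint_diff[OF gs sqint_const[OF finite_measure_dball]] norm_clip_diff_le[OF N]])
      (use m in measurable)
  with c show "\<exists>c. (near x r \<longrightarrow> c = 0) \<and>
          nrm2 ?L (\<lambda>y. clip N (g y) - c) \<le> M * sqrt (measure lebesgue (dball x r))"
    using clip_self[of 0 N] N by (intro exI[of _ "clip N c"]) auto
qed

text \<open>Subtracting \<open>c\<close> from \<open>g\<close> leaves the integral unchanged: either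
  \<open>f\<close> has mean zero, or the ball is near and \<open>c = 0\<close>. Cauchy-Schwarz on
  the ball does the rest.\<close>

lemma test_pairing:
  assumes g: "osc_bound g M" and x: "x \<in> \<Omega>" "0 < r" and f: "test x r f"
  shows "integrable (lebesgue_on \<Omega>) (\<lambda>y. g y * f y)"
    and "norm (LINT y|lebesgue_on \<Omega>. g y * f y) \<le>
      M * (nrm2 (lebesgue_on \<Omega>) f * sqrt (measure lebesgue (dball x r)))"
proof -
  let ?L = "lebesgue_on (dball x r)"
  have gm: "g \<in> borel_measurable (lebesgue_on \<Omega>)"
    using g by (simp add: osc_bound_def)
  obtain c where gs: "g \<in> sqint ?L" and c: "near x r \<longrightarrow> c = 0"
      "nrm2 ?L (\<lambda>y. g y - c) \<le> M * sqrt (measure lebesgue (dball x r))"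
    using g x unfolding osc_bound_def by meson
  have fs: "f \<in> sqint (lebesgue_on \<Omega>)" and ae: "AE y in lebesgue_on \<Omega>. y \<notin> dball x r \<longrightarrow> f y = 0"
    and f0: "(LINT y|lebesgue_on \<Omega>. f y) = 0 \<or> near x r"
    using f by (auto simp: test_def)
  have sets: "dball x r \<in> sets lebesgue" "\<Omega> \<in> sets lebesgue" "dball x r \<subseteq> \<Omega>"
    by auto
  have fL: "f \<in> sqint ?L"
    by (rule sqint_subset[OF sets fs])
  show "integrable (lebesgue_on \<Omega>) (\<lambda>y. g y * f y)"
    by (rule integral_pairing(1)[OF sets gm gs fs ae])
  have const: "(\<lambda>y. c) \<in> sqint ?L"
    by (rule sqint_const[OF finite_measure_dball])
  have "(LINT y|?L. c * f y) = (LINT y|lebesgue_on \<Omega>. c * f y)"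
    by (rule integral_pairing(2)[OF sets _ const fs ae, symmetric]) simp
  also have "\<dots> = 0"
    using f0 c(1) by auto
  finally have "(LINT y|lebesgue_on \<Omega>. g y * f y) = (LINT y|?L. (g y - c) * f y)"
    using integral_pairing(2)[OF sets gm gs fs ae]
      sqint_mult_integrable[OF gs fL] sqint_mult_integrable[OF const fL]
    by (simp add: left_diff_distrib)
  also have "norm \<dots> \<le> nrm2 ?L (\<lambda>y. g y - c) * nrm2 ?L f"
    by (rule sqint_norm_integral_le[OF sqint_diff[OF gs const] fL])
  also have "\<dots> \<le> (M * sqrt (measure lebesgue (dball x r))) * nrm2 (lebesgue_on \<Omega>) f"
    using osc_bound_nonneg[OF g] by (intro mult_mono c(2) nrm2_subset_le[OF sets fs]) auto
  finally show "norm (LINT y|lebesgue_on \<Omega>. g y * f y) \<le>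
      M * (nrm2 (lebesgue_on \<Omega>) f * sqrt (measure lebesgue (dball x r)))"
    by (simp add: mult_ac)
qed

lemma atom_pairing:
  assumes g: "osc_bound g M" and a: "H1_atom \<Omega> D a"
  shows "integrable (lebesgue_on \<Omega>) (\<lambda>y. g y * a y)"
    and "norm (LINT y|lebesgue_on \<Omega>. g y * a y) \<le> M"
proof -
  obtain x r where x: "x \<in> \<Omega>" "0 < r" "test x r a"
    and le: "nrm2 (lebesgue_on \<Omega>) a * sqrt (measure lebesgue (dball x r)) \<le> 1"
    using a unfolding H1_atom_iff by blast
  show "integrable (lebesgue_on \<Omega>) (\<lambda>y. g y * a y)"
    by (rule test_pairing(1)[OF g x])
  show "norm (LINT y|lebesgue_on \<Omega>. g y * a y) \<le> M"
    using test_pairing(2)[OF g x] mult_left_mono[OF le osc_bound_nonneg[OF g]] by simp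
qed

text \<open>Atoms have L^1 norm at most 1, so for bounded \<open>g\<close> the series converges
  absolutely in L^1, with total at most \<open>N\<close> times the coefficient sum, and sum and
  integral may be exchanged.\<close>

lemma decomp_pairing:
  assumes dec: "atomic_decomp \<Omega> D f l a"
    and g: "g \<in> borel_measurable (lebesgue_on \<Omega>)" and N: "\<And>x. norm (g x) \<le> N"
  shows "integrable (lebesgue_on \<Omega>) (\<lambda>y. g y * f y)"
    and "(\<lambda>j. l j * (LINT y|lebesgue_on \<Omega>. g y * a j y)) sums (LINT y|lebesgue_on \<Omega>. g y * f y)"
proof -
  have atom: "H1_atom \<Omega> D (a j)" for j
    using dec by (simp add: atomic_decomp_def)
  have suml: "summable (\<lambda>j. norm (l j))"
    and ae: "AE x in lebesgue_on \<Omega>. (\<lambda>j. l j * a j x) sums f x"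
    using dec by (auto simp: atomic_decomp_def)
  note [measurable] = g borel_measurable_integrable[OF atom_integrable[OF atom]]
  have N0: "0 \<le> N" using N order_trans norm_ge_zero by blast
  define F where "F j y = l j * (g y * a j y)" for j y
  have inta: "integrable (lebesgue_on \<Omega>) (\<lambda>y. g y * a j y)" for j
  proof (rule Bochner_Integration.integrable_bound)
    show "integrable (lebesgue_on \<Omega>) (\<lambda>y. N * norm (a j y))"
      by (intro integrable_mult_right integrable_norm atom_integrable atom)
    show "AE y in lebesgue_on \<Omega>. norm (g y * a j y) \<le> norm (N * norm (a j y))"
      using N0 by (simp add: norm_mult mult_right_mono[OF N])
  qed measurable
  then have intF: "integrable (lebesgue_on \<Omega>) (F j)" for j
    unfolding F_def by (intro integrable_mult_right)
  have sumF: "summable (\<lambda>j. LINT y|lebesgue_on \<Omega>. norm (F j y))"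
  proof (rule summable_comparison_test')
    show "summable (\<lambda>j. norm (l j) * N)"
      by (intro summable_mult2 suml)
    fix j
    have "(LINT y|lebesgue_on \<Omega>. norm (F j y)) \<le> (LINT y|lebesgue_on \<Omega>. norm (l j) * (N * norm (a j y)))"
      using N N0 by (intro Bochner_Integration.integral_mono integrable_norm intF integrable_mult_right atom_integrable atom)
        (auto simp: F_def norm_mult intro!: mult_mono)
    also have "\<dots> = norm (l j) * (N * (LINT y|lebesgue_on \<Omega>. norm (a j y)))"
      by simp
    also have "\<dots> \<le> norm (l j) * (N * 1)"
      using N0 by (intro mult_left_mono atom_integral_le atom) auto
    finally show "norm (LINT y|lebesgue_on \<Omega>. norm (F j y)) \<le> norm (l j) * N"
      by simp
  qed
  have aeF: "AE y in lebesgue_on \<Omega>. summable (\<lambda>j. norm (F j y))"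
    by (rule AE_summable_norm[OF intF sumF])
  \<comment> \<open>\<open>f\<close> equals the pointwise sum of its series only almost everywhere,
    so completeness of the measure enters.\<close>
  have f_meas: "f \<in> borel_measurable (lebesgue_on \<Omega>)"
  proof -
    have m: "(\<lambda>x. \<Sum>j. l j * a j x) \<in> borel_measurable (lebesgue_on \<Omega>)"
      by measurable
    have "AE x in lebesgue_on \<Omega>. (\<Sum>j. l j * a j x) = f x"
      using ae by eventually_elim (simp add: sums_iff)
    with m show ?thesis
      by (rule borel_measurable_AE_domain)
  qed
  have gf: "AE y in lebesgue_on \<Omega>. (\<Sum>j. F j y) = g y * f y"
    using ae
  proof eventually_elim
    case (elim y)
    then have "(\<lambda>j. g y * (l j * a j y)) sums (g y * f y)"
      by (rule sums_mult)
    then show ?case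
      by (simp add: F_def sums_iff mult_ac)
  qed
  have mF: "(\<lambda>y. \<Sum>j. F j y) \<in> borel_measurable (lebesgue_on \<Omega>)"
    using borel_measurable_integrable[OF intF] by measurable
  have mgf: "(\<lambda>y. g y * f y) \<in> borel_measurable (lebesgue_on \<Omega>)"
    using f_meas by measurable
  show "integrable (lebesgue_on \<Omega>) (\<lambda>y. g y * f y)"
    by (rule integrable_cong_AE_imp[OF integrable_suminf[OF intF aeF sumF] mgf])
      (use gf in \<open>eventually_elim; simp\<close>)
  have "(\<lambda>j. integral\<^sup>L (lebesgue_on \<Omega>) (F j)) sums (LINT y|lebesgue_on \<Omega>. (\<Sum>j. F j y))"
    by (rule sums_integral[OF intF aeF sumF])
  moreover have "(LINT y|lebesgue_on \<Omega>. (\<Sum>j. F j y)) = (LINT y|lebesgue_on \<Omega>. g y * f y)"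
    by (rule integral_cong_AE[OF mF mgf gf])
  ultimately show "(\<lambda>j. l j * (LINT y|lebesgue_on \<Omega>. g y * a j y)) sums (LINT y|lebesgue_on \<Omega>. g y * f y)"
    by (simp add: F_def[abs_def])
qed

text \<open>The crux of well-definedness: the left side depends on \<open>f\<close> alone, the right
  side on the decomposition. Each term converges by dominated convergence, and since truncation
  preserves \<open>osc_bound g M\<close>, all terms are dominated by \<open>M * norm (l j)\<close>
  independently of \<open>n\<close>, as Tannery's theorem requires.\<close>

lemma clip_pairing_tendsto:
  assumes g: "osc_bound g M" and dec: "atomic_decomp \<Omega> D f l a"
  shows "(\<lambda>n. LINT y|lebesgue_on \<Omega>. clip (real n) (g y) * f y) \<longlonglongrightarrow>
      (\<Sum>j. l j * (LINT y|lebesgue_on \<Omega>. g y * a j y))"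
    and "norm (\<Sum>j. l j * (LINT y|lebesgue_on \<Omega>. g y * a j y)) \<le> M * (\<Sum>j. norm (l j))"
proof -
  have atom: "H1_atom \<Omega> D (a j)" for j
    using dec by (simp add: atomic_decomp_def)
  have suml: "summable (\<lambda>j. norm (l j))"
    using dec by (auto simp: atomic_decomp_def)
  have gm: "g \<in> borel_measurable (lebesgue_on \<Omega>)"
    using g by (simp add: osc_bound_def)
  have clipb: "osc_bound (\<lambda>x. clip (real n) (g x)) M" for n
    by (rule osc_bound_clip[OF g]) simp
  then have clipm: "(\<lambda>x. clip (real n) (g x)) \<in> borel_measurable (lebesgue_on \<Omega>)" for n
    by (simp add: osc_bound_def)
  have lim: "(\<lambda>n. l j * (LINT y|lebesgue_on \<Omega>. clip (real n) (g y) * a j y)) \<longlonglongrightarrow>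
      l j * (LINT y|lebesgue_on \<Omega>. g y * a j y)" for j
  proof (intro tendsto_mult tendsto_const integral_dominated_convergence)
    show "integrable (lebesgue_on \<Omega>) (\<lambda>y. norm (g y * a j y))"
      by (intro integrable_norm atom_pairing(1)[OF g atom])
    show "(\<lambda>y. clip (real n) (g y) * a j y) \<in> borel_measurable (lebesgue_on \<Omega>)" for n
      using atom_pairing(1)[OF clipb atom] by (rule borel_measurable_integrable)
    show "(\<lambda>y. g y * a j y) \<in> borel_measurable (lebesgue_on \<Omega>)"
      using atom_pairing(1)[OF g atom] by (rule borel_measurable_integrable)
    show "AE y in lebesgue_on \<Omega>. (\<lambda>n. clip (real n) (g y) * a j y) \<longlonglongrightarrow> g y * a j y"
      by (intro AE_I2 tendsto_mult clip_tendsto tendsto_const)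
    show "AE y in lebesgue_on \<Omega>. norm (clip (real n) (g y) * a j y) \<le> norm (g y * a j y)" for n
      by (auto simp: norm_mult intro!: AE_I2 mult_right_mono norm_clip_le)
  qed
  have bound: "norm (l j * (LINT y|lebesgue_on \<Omega>. h y * a j y)) \<le> M * norm (l j)"
    if "osc_bound h M" for h j
    using mult_left_mono[OF atom_pairing(2)[OF that atom, of j], of "norm (l j)"]
    by (simp add: norm_mult mult.commute)
  have sumM: "summable (\<lambda>j. M * norm (l j))"
    by (intro summable_mult suml)
  have "(\<lambda>n. \<Sum>j. l j * (LINT y|lebesgue_on \<Omega>. clip (real n) (g y) * a j y)) \<longlonglongrightarrow>
      (\<Sum>j. l j * (LINT y|lebesgue_on \<Omega>. g y * a j y))"
    by (rule tannerys_theorem[OF lim _ sumM, THEN conjunct2, THEN conjunct2])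
      (auto intro!: always_eventually bound[OF clipb])
  moreover have "(\<Sum>j. l j * (LINT y|lebesgue_on \<Omega>. clip (real n) (g y) * a j y)) =
      (LINT y|lebesgue_on \<Omega>. clip (real n) (g y) * f y)" for n
    using decomp_pairing(2)[OF dec clipm, of n "real n"] norm_clip_bound[of "real n"]
    by (simp add: sums_iff)
  ultimately show "(\<lambda>n. LINT y|lebesgue_on \<Omega>. clip (real n) (g y) * f y) \<longlonglongrightarrow>
      (\<Sum>j. l j * (LINT y|lebesgue_on \<Omega>. g y * a j y))"
    by simp
  have "norm (\<Sum>j. l j * (LINT y|lebesgue_on \<Omega>. g y * a j y)) \<le> (\<Sum>j. M * norm (l j))"
    by (rule norm_suminf_le[OF bound[OF g] sumM])
  then show "norm (\<Sum>j. l j * (LINT y|lebesgue_on \<Omega>. g y * a j y)) \<le> M * (\<Sum>j. norm (l j))"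
    by (simp add: suminf_mult[OF suml])
qed

text \<open>Integrability against single atoms is assumed rather than derived from an oscillation
  bound, so that both directions of the duality can use it.\<close>

lemma H1_fin_pairing:
  fixes n :: nat
  assumes "\<And>j. j < n \<Longrightarrow> H1_atom \<Omega> D (a j)"
    and "AE x in lebesgue_on \<Omega>. f x = (\<Sum>j<n. l j * a j x)"
    and g: "\<And>j. j < n \<Longrightarrow> integrable (lebesgue_on \<Omega>) (\<lambda>x. g x * a j x)"
    and gm: "g \<in> borel_measurable (lebesgue_on \<Omega>)"
  shows "integrable (lebesgue_on \<Omega>) (\<lambda>x. g x * f x)"
    and "(LINT x|lebesgue_on \<Omega>. g x * f x) = (\<Sum>j<n. l j * (LINT x|lebesgue_on \<Omega>. g x * a j x))"
proof -
  \<comment> \<open>Pairing with the constant 1 gives integrability, hence measurability, of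
    \<open>f\<close>.\<close>
  have "f \<in> borel_measurable (lebesgue_on \<Omega>)"
    using decomp_pairing(1)[OF atomic_decomp_finite[OF assms(1,2)], of "\<lambda>_. 1" 1]
    by (simp add: borel_measurable_integrable)
  then have m: "(\<lambda>x. g x * f x) \<in> borel_measurable (lebesgue_on \<Omega>)"
    using gm by measurable
  have inta: "integrable (lebesgue_on \<Omega>) (\<lambda>x. l j * (g x * a j x))" if "j < n" for j
    by (intro integrable_mult_right g that)
  then have ints: "integrable (lebesgue_on \<Omega>) (\<lambda>x. \<Sum>j<n. l j * (g x * a j x))"
    by (intro Bochner_Integration.integrable_sum) auto
  have ae: "AE x in lebesgue_on \<Omega>. (\<Sum>j<n. l j * (g x * a j x)) = g x * f x"
    using assms(2) by eventually_elim (simp add: sum_distrib_left mult_ac)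
  show "integrable (lebesgue_on \<Omega>) (\<lambda>x. g x * f x)"
    by (rule integrable_cong_AE_imp[OF ints m]) (use ae in \<open>eventually_elim; simp\<close>)
  have "(LINT x|lebesgue_on \<Omega>. g x * f x) = (LINT x|lebesgue_on \<Omega>. (\<Sum>j<n. l j * (g x * a j x)))"
    by (rule integral_cong_AE[OF borel_measurable_integrable[OF ints] m ae, symmetric])
  also have "\<dots> = (\<Sum>j<n. l j * (LINT y|lebesgue_on \<Omega>. g y * a j y))"
    using inta by (subst Bochner_Integration.integral_sum) auto
  finally show "(LINT x|lebesgue_on \<Omega>. g x * f x) = (\<Sum>j<n. l j * (LINT x|lebesgue_on \<Omega>. g x * a j x))" .
qed

lemma zero_H1: "(\<lambda>x. 0) \<in> H1 \<Omega> D" and H1_norm_zero: "H1_norm \<Omega> D (\<lambda>x. 0) \<le> 0"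
proof -
  have dec: "atomic_decomp \<Omega> D (\<lambda>x. 0) (\<lambda>j. 0) (\<lambda>j x. 0)"
    by (simp add: atomic_decomp_def zero_atom)
  then show "(\<lambda>x. 0) \<in> H1 \<Omega> D" by (auto simp: H1_def)
  show "H1_norm \<Omega> D (\<lambda>x. 0) \<le> 0"
    using H1_norm_le[OF dec] by simp
qed

text \<open>Linearity is inherited from the truncated pairings, whose integrals exist on all of
  \<open>H1\<close>; boundedness and the value on finite combinations are read off from the
  series.\<close>

theorem BMO_represents_functional:
  assumes "osc_bound g M"
  shows "\<exists>L\<in>H1_dual \<Omega> D. represented_by \<Omega> D L g \<and> H1_dual_norm \<Omega> D L \<le> M"
proof -
  define I where "I n f = (LINT y|lebesgue_on \<Omega>. clip (real n) (g y) * f y)" for n f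
  \<comment> \<open>A limit of expressions in \<open>f\<close> alone, so no decomposition has to be
    chosen.\<close>
  define L where "L f = lim (\<lambda>n. I n f)" for f
  have L_eq: "L f = (\<Sum>j. l j * (LINT y|lebesgue_on \<Omega>. g y * a j y))"
    if "atomic_decomp \<Omega> D f l a" for f l a
    unfolding L_def I_def by (rule limI[OF clip_pairing_tendsto(1)[OF assms that]])
  have lim: "(\<lambda>n. I n f) \<longlonglongrightarrow> L f" and int: "integrable (lebesgue_on \<Omega>) (\<lambda>y. clip (real n) (g y) * f y)"
    if f: "f \<in> H1 \<Omega> D" for f n
  proof -
    obtain l a where dec: "atomic_decomp \<Omega> D f l a"
      using f by (auto simp: H1_def)
    show "(\<lambda>n. I n f) \<longlonglongrightarrow> L f"
      using clip_pairing_tendsto(1)[OF assms dec] by (simp add: L_eq[OF dec] I_def)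
    have "(\<lambda>x. clip (real n) (g x)) \<in> borel_measurable (lebesgue_on \<Omega>)"
      using osc_bound_clip[OF assms, of "real n"] by (simp add: osc_bound_def)
    then show "integrable (lebesgue_on \<Omega>) (\<lambda>y. clip (real n) (g y) * f y)"
      by (rule decomp_pairing(1)[OF dec]) (rule norm_clip_bound, simp)
  qed
  have bound: "norm (L f) \<le> M * H1_norm \<Omega> D f" if f: "f \<in> H1 \<Omega> D" for f
  proof (rule field_le_epsilon)
    fix e :: real assume e: "0 < e"
    have M: "0 \<le> M" by (rule osc_bound_nonneg[OF assms])
    \<comment> \<open>Leads to a nearly optimal decomposition; \<open>M + 1\<close> instead of
      \<open>M\<close> allows \<open>M = 0\<close>, and \<open>M * (e / (M + 1))\<close> is at most
      \<open>e\<close>.\<close>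
    have "H1_norm \<Omega> D f < H1_norm \<Omega> D f + e / (M + 1)"
      using e M by simp
    then obtain l a where dec: "atomic_decomp \<Omega> D f l a"
      and le: "(\<Sum>j. norm (l j)) < H1_norm \<Omega> D f + e / (M + 1)"
      using H1_norm_less_decomp[OF f] by blast
    have "norm (L f) \<le> M * (\<Sum>j. norm (l j))"
      unfolding L_eq[OF dec] by (rule clip_pairing_tendsto(2)[OF assms dec])
    also have "\<dots> \<le> M * (H1_norm \<Omega> D f + e / (M + 1))"
      using le M by (intro mult_left_mono) auto
    also have "\<dots> \<le> M * H1_norm \<Omega> D f + e"
      using e M by (simp add: field_simps)
    finally show "norm (L f) \<le> M * H1_norm \<Omega> D f + e" .
  qed
  have "L (\<lambda>x. f x + h x) = L f + L h" if "f \<in> H1 \<Omega> D" "h \<in> H1 \<Omega> D" for f h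
  proof -
    have "I n (\<lambda>x. f x + h x) = I n f + I n h" for n
      using int[OF that(1), of n] int[OF that(2), of n] by (simp add: I_def distrib_left)
    moreover have "(\<lambda>n. I n f + I n h) \<longlonglongrightarrow> L f + L h"
      by (intro tendsto_add lim that)
    ultimately show ?thesis
      unfolding L_def[of "\<lambda>x. f x + h x"] by (simp add: limI)
  qed
  moreover have "L (\<lambda>x. z * f x) = z * L f" if "f \<in> H1 \<Omega> D" for f z
  proof -
    have "I n (\<lambda>x. z * f x) = z * I n f" for n
    proof -
      have "(\<lambda>y. clip (real n) (g y) * (z * f y)) = (\<lambda>y. z * (clip (real n) (g y) * f y))"
        by (simp add: mult_ac)
      then show ?thesis by (simp add: I_def)
    qed
    moreover have "(\<lambda>n. z * I n f) \<longlonglongrightarrow> z * L f"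
      by (intro tendsto_mult tendsto_const lim that)
    ultimately show ?thesis
      unfolding L_def[of "\<lambda>x. z * f x"] by (simp add: limI)
  qed
  ultimately have dual: "L \<in> H1_dual \<Omega> D"
    unfolding H1_dual_def using bound by blast
  have "represented_by \<Omega> D L g"
    unfolding represented_by_def
  proof (intro ballI conjI)
    fix f assume "f \<in> H1_fin \<Omega> D"
    then obtain n :: nat and l a where atoms: "\<And>j. j < n \<Longrightarrow> H1_atom \<Omega> D (a j)"
      and f: "AE x in lebesgue_on \<Omega>. f x = (\<Sum>j<n. l j * a j x)"
      unfolding H1_fin_def by blast
    have dec: "atomic_decomp \<Omega> D f (\<lambda>j. if j < n then l j else 0) (\<lambda>j. if j < n then a j else (\<lambda>_. 0))"
      by (rule atomic_decomp_finite[OF atoms f])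
    have gm: "g \<in> borel_measurable (lebesgue_on \<Omega>)"
      using assms by (simp add: osc_bound_def)
    have inta: "integrable (lebesgue_on \<Omega>) (\<lambda>x. g x * a j x)" if "j < n" for j
      by (intro atom_pairing(1)[OF assms] atoms that)
    show "integrable (lebesgue_on \<Omega>) (\<lambda>x. g x * f x)"
      by (rule H1_fin_pairing(1)[OF atoms f inta gm])
    have "L f = (\<Sum>j. if j \<in> {..<n} then l j * (LINT y|lebesgue_on \<Omega>. g y * a j y) else 0)"
      unfolding L_eq[OF dec] by (intro suminf_cong) auto
    also have "\<dots> = (\<Sum>j<n. l j * (LINT y|lebesgue_on \<Omega>. g y * a j y))"
      by (rule sums_unique[symmetric], rule sums_If_finite_set) simp
    also have "\<dots> = (LINT x|lebesgue_on \<Omega>. g x * f x)"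
      by (rule H1_fin_pairing(2)[OF atoms f inta gm, symmetric])
    finally show "L f = (LINT x|lebesgue_on \<Omega>. g x * f x)" .
  qed
  moreover have "H1_dual_norm \<Omega> D L \<le> M"
    unfolding H1_dual_norm_def
  proof (rule cSUP_least)
    show "{f \<in> H1 \<Omega> D. H1_norm \<Omega> D f \<le> 1} \<noteq> {}"
      using zero_H1 H1_norm_zero by fastforce
    fix f assume f: "f \<in> {f \<in> H1 \<Omega> D. H1_norm \<Omega> D f \<le> 1}"
    then have "M * H1_norm \<Omega> D f \<le> M * 1"
      using osc_bound_nonneg[OF assms] by (intro mult_left_mono) auto
    then show "norm (L f) \<le> M"
      using bound[of f] f by simp
  qed
  ultimately show ?thesis
    using dual by blast
qed

subsection \<open>The BMO function of a functional\<close>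

text \<open>A converse of \<open>test_pairing\<close> by duality on one ball: the conjugate of
  \<open>g - c\<close>, extended by zero, is itself a test function, and \<open>c\<close> times that
  conjugate integrates to zero, whether the mean of \<open>g - c\<close> vanishes or
  \<open>c = 0\<close>. The pairing is thus the square of the norm to be bounded.\<close>

lemma test_bound_nrm2_le:
  assumes gm: "g \<in> borel_measurable (lebesgue_on \<Omega>)" and gs: "g \<in> sqint (lebesgue_on (dball x r))"
    and bound: "\<And>f. test x r f \<Longrightarrow> norm (LINT y|lebesgue_on \<Omega>. g y * f y) \<le>
      M * (nrm2 (lebesgue_on \<Omega>) f * sqrt (measure lebesgue (dball x r)))"
    and M: "0 \<le> M"
    and c: "(LINT y|lebesgue_on (dball x r). g y - c) = 0 \<or> (c = 0 \<and> near x r)"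
  shows "nrm2 (lebesgue_on (dball x r)) (\<lambda>y. g y - c) \<le> M * sqrt (measure lebesgue (dball x r))"
proof -
  let ?L = "lebesgue_on (dball x r)"
  define u where "u y = g y - c" for y
  define f where "f = zero_outside (dball x r) (\<lambda>y. cnj (u y))"
  have u0: "(LINT y|?L. u y) = 0 \<or> (c = 0 \<and> near x r)"
    using c by (simp only: u_def)
  have sets: "dball x r \<in> sets lebesgue" "\<Omega> \<in> sets lebesgue" "dball x r \<subseteq> \<Omega>"
    by auto
  have const: "(\<lambda>y. c) \<in> sqint ?L"
    by (rule sqint_const[OF finite_measure_dball])
  have u: "u \<in> sqint ?L"
    unfolding u_def by (rule sqint_diff[OF gs const])
  have fs: "f \<in> sqint (lebesgue_on \<Omega>)"
    unfolding f_def sqint_zero_outside[OF sets] by (rule sqint_cnj[OF u])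
  have ae: "AE y in lebesgue_on \<Omega>. y \<notin> dball x r \<longrightarrow> f y = 0"
    by (simp add: f_def zero_outside_def)
  have "(LINT y|lebesgue_on \<Omega>. f y) = cnj (LINT y|?L. u y)"
    unfolding f_def integral_zero_outside[OF sets] by simp
  then have test: "test x r f"
    using u0 fs ae by (auto simp: test_def)
  have "(LINT y|lebesgue_on \<Omega>. g y * f y) = (LINT y|?L. g y * f y)"
    by (rule integral_pairing(2)[OF sets gm gs fs ae])
  also have "\<dots> = (LINT y|?L. u y * cnj (u y) + c * cnj (u y))"
    by (rule Bochner_Integration.integral_cong) (auto simp: f_def zero_outside_def u_def algebra_simps)
  also have "\<dots> = (LINT y|?L. u y * cnj (u y)) + (LINT y|?L. c * cnj (u y))"
    by (intro Bochner_Integration.integral_add sqint_mult_integrable sqint_cnj u const)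
  also have "(LINT y|?L. c * cnj (u y)) = 0"
    using u0 by auto
  also have "(LINT y|?L. u y * cnj (u y)) = of_real ((nrm2 ?L u)\<^sup>2)"
    by (simp add: nrm2_power2 flip: complex_norm_square Bochner_Integration.integral_complex_of_real)
  finally have "(nrm2 ?L u)\<^sup>2 \<le> M * (nrm2 (lebesgue_on \<Omega>) f * sqrt (measure lebesgue (dball x r)))"
    using bound[OF test] by (simp add: norm_power)
  also have "nrm2 (lebesgue_on \<Omega>) f = nrm2 ?L u"
    unfolding f_def nrm2_zero_outside[OF sets] by (simp add: nrm2_def)
  finally have "nrm2 ?L u * nrm2 ?L u \<le> nrm2 ?L u * (M * sqrt (measure lebesgue (dball x r)))"
    by (simp add: power2_eq_square mult_ac)
  \<comment> \<open>One factor \<open>nrm2 ?L u\<close> cancels; if it is zero,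
    \<open>0 \<le> M\<close> gives the claim.\<close>
  then have "nrm2 ?L u \<le> M * sqrt (measure lebesgue (dball x r))"
    using nrm2_nonneg[of ?L u] M by (cases "nrm2 ?L u = 0") (auto simp: mult_le_cancel_left)
  then show ?thesis
    by (simp add: u_def[abs_def])
qed

text \<open>\<open>c\<close> is the mean on an arbitrary ball and \<open>0\<close> on a near one.
  This serves both for the bound on the representing function and, with \<open>M = 0\<close>, for
  uniqueness.\<close>

lemma BMO_seminorm_le:
  assumes gm: "g \<in> borel_measurable (lebesgue_on \<Omega>)" and gs: "\<And>x r. g \<in> sqint (lebesgue_on (dball x r))"
    and M: "0 \<le> M"
    and bound: "\<And>x r f. x \<in> \<Omega> \<Longrightarrow> 0 < r \<Longrightarrow> test x r f \<Longrightarrow> norm (LINT y|lebesgue_on \<Omega>. g y * f y) \<le>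
      M * (nrm2 (lebesgue_on \<Omega>) f * sqrt (measure lebesgue (dball x r)))"
  shows "BMO_seminorm \<Omega> D g \<le> ennreal M"
proof -
  have "L2_mean (dball x r) (\<lambda>y. g y - mean (dball x r) g) \<le> M" if x: "x \<in> \<Omega>" "0 < r" for x r
  proof -
    let ?L = "lebesgue_on (dball x r)"
    have fin: "finite_measure ?L" by (rule finite_measure_dball)
    have "integrable ?L g"
      using sqint_mult_integrable[OF gs sqint_const[OF fin, of 1]] by simp
    then have "(LINT y|?L. g y - mean (dball x r) g) =
        (LINT y|?L. g y) - measure lebesgue (dball x r) *\<^sub>R mean (dball x r) g"
      using finite_measure.integrable_const[OF fin, of "mean (dball x r) g"]
      by (simp add: measure_restrict_space)
    also have "\<dots> = 0"
      using measure_dball_pos[OF x] by (simp add: mean_def)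
    finally show ?thesis
      unfolding L2_mean_le_iff[OF x] by (intro test_bound_nrm2_le gm gs bound x M) auto
  qed
  moreover have "L2_mean (dball x r) g \<le> M" if x: "x \<in> \<Omega>" "0 < r" "near x r" for x r
    unfolding L2_mean_le_iff[OF x(1,2)]
    using test_bound_nrm2_le[OF gm gs bound M, of x r 0] x by simp
  ultimately show ?thesis
    unfolding BMO_seminorm_def
    by (intro max.boundedI SUP_least ennreal_leI) (auto simp: usual_balls_eq near_balls_eq)
qed

lemma test_H1_fin:
  assumes "x \<in> \<Omega>" "0 < r" "test x r f"
  shows "f \<in> H1_fin \<Omega> D"
proof -
  \<comment> \<open>Adding 1 makes the divisor positive also for null functions.\<close>
  define \<kappa> where "\<kappa> = nrm2 (lebesgue_on \<Omega>) f * sqrt (measure lebesgue (dball x r)) + 1"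
  have \<kappa>: "0 < \<kappa>"
    by (simp add: \<kappa>_def add_nonneg_pos)
  have "H1_atom \<Omega> D (\<lambda>y. of_real (1/\<kappa>) * f y)"
    using \<kappa> by (intro test_atom[OF assms]) (auto simp: \<kappa>_def)
  from atom_H1_fin[OF this, of "of_real \<kappa>"] show ?thesis
    using \<kappa> by simp
qed

end

section \<open>Bounded functionals on \<open>H1\<close>\<close>

locale H1_functional = one_component +
  fixes L :: "('a \<Rightarrow> complex) \<Rightarrow> complex"
  assumes dual: "L \<in> H1_dual \<Omega> D"
begin

abbreviation "K \<equiv> H1_dual_norm \<Omega> D L"

lemma L_add: "f \<in> H1 \<Omega> D \<Longrightarrow> g \<in> H1 \<Omega> D \<Longrightarrow> L (\<lambda>x. f x + g x) = L f + L g"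
  and L_scale: "f \<in> H1 \<Omega> D \<Longrightarrow> L (\<lambda>x. z * f x) = z * L f"
  using dual by (auto simp: H1_dual_def)

text \<open>The real supremum in \<open>H1_dual_norm\<close> dominates its members only if they are
  bounded above. The constant from \<open>H1_dual\<close> provides this, through its absolute value
  since its sign is not prescribed.\<close>

lemma L_le_K:
  assumes "f \<in> H1 \<Omega> D" "H1_norm \<Omega> D f \<le> 1"
  shows "norm (L f) \<le> K"
proof -
  obtain C where C: "\<forall>f\<in>H1 \<Omega> D. norm (L f) \<le> C * H1_norm \<Omega> D f"
    using dual unfolding H1_dual_def by blast
  have "norm (L f) \<le> \<bar>C\<bar>" if f: "f \<in> H1 \<Omega> D" "H1_norm \<Omega> D f \<le> 1" for f
  proof -
    have "norm (L f) \<le> C * H1_norm \<Omega> D f"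
      using C f by blast
    also have "\<dots> \<le> \<bar>C\<bar> * H1_norm \<Omega> D f"
      using H1_norm_nonneg[OF f(1)] by (intro mult_right_mono) auto
    also have "\<dots> \<le> \<bar>C\<bar> * 1"
      using f by (intro mult_left_mono) auto
    finally show ?thesis by simp
  qed
  then have "bdd_above ((\<lambda>f. norm (L f)) ` {f \<in> H1 \<Omega> D. H1_norm \<Omega> D f \<le> 1})"
    by (intro bdd_aboveI2[of _ _ "\<bar>C\<bar>"]) auto
  then show ?thesis
    unfolding H1_dual_norm_def by (rule cSUP_upper2) (use assms in auto)
qed

lemma K_nonneg: "0 \<le> K"
  using L_le_K[OF zero_H1] H1_norm_zero norm_ge_zero[of "L (\<lambda>x. 0)"] by linarith

text \<open>Such an \<open>f\<close> has a decomposition with zero coefficients, hence norm zero,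
  and boundedness forces \<open>L f = 0\<close>. So \<open>L\<close> respects equality almost
  everywhere.\<close>

lemma L_AE_zero:
  assumes "AE x in lebesgue_on \<Omega>. f x = 0"
  shows "f \<in> H1 \<Omega> D" and "L f = 0"
proof -
  have dec: "atomic_decomp \<Omega> D f (\<lambda>j. 0) (\<lambda>j x. 0)"
    using assms by (auto simp: atomic_decomp_def zero_atom)
  then show f: "f \<in> H1 \<Omega> D" by (auto simp: H1_def)
  have "H1_norm \<Omega> D f = 0"
    using H1_norm_le[OF dec] H1_norm_nonneg[OF f] by simp
  moreover obtain C where "\<forall>f\<in>H1 \<Omega> D. norm (L f) \<le> C * H1_norm \<Omega> D f"
    using dual unfolding H1_dual_def by blast
  ultimately show "L f = 0"
    using f by fastforce
qed

lemma L_AE_cong: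
  assumes f: "f \<in> H1 \<Omega> D" and ae: "AE x in lebesgue_on \<Omega>. f x = g x"
  shows "L g = L f"
proof -
  have "AE x in lebesgue_on \<Omega>. g x - f x = 0"
    using ae by eventually_elim simp
  from L_add[OF f L_AE_zero(1)[OF this]] L_AE_zero(2)[OF this] show ?thesis
    by simp
qed

text \<open>A test function divided by \<open>\<kappa>\<close> is an atom, on which \<open>L\<close>
  is at most \<open>K\<close> in modulus. The slack \<open>e / (K + 1)\<close> keeps
  \<open>\<kappa>\<close> positive when \<open>f\<close> is null and contributes at most
  \<open>e\<close>.\<close>

lemma L_test_bound:
  assumes x: "x \<in> \<Omega>" "0 < r" and f: "test x r f"
  shows "norm (L f) \<le> K * (nrm2 (lebesgue_on \<Omega>) f * sqrt (measure lebesgue (dball x r)))"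
proof (rule field_le_epsilon)
  fix e :: real assume e: "0 < e"
  define N where "N = nrm2 (lebesgue_on \<Omega>) f * sqrt (measure lebesgue (dball x r))"
  define \<kappa> where "\<kappa> = N + e / (K + 1)"
  have \<kappa>: "0 < \<kappa>" "N \<le> \<kappa>"
    using e K_nonneg by (auto simp: \<kappa>_def N_def add_nonneg_pos)
  let ?a = "\<lambda>y. of_real (1/\<kappa>) * f y"
  have a: "H1_atom \<Omega> D ?a"
    using \<kappa> by (intro test_atom[OF x f]) (auto simp: N_def)
  have "?a \<in> H1_fin \<Omega> D"
    using atom_H1_fin[OF a, of 1] by simp
  then have aH: "?a \<in> H1 \<Omega> D"
    using H1_fin_subset by blast
  have "L f = of_real \<kappa> * L ?a"
    using L_scale[OF aH, of "of_real \<kappa>"] \<kappa> by simp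
  then have "norm (L f) = \<kappa> * norm (L ?a)"
    using \<kappa> by (simp add: norm_mult)
  also have "\<dots> \<le> \<kappa> * K"
    using \<kappa> by (intro mult_left_mono L_le_K aH H1_norm_atom_le a) auto
  also have "\<dots> \<le> K * N + e"
    using e K_nonneg by (simp add: \<kappa>_def field_simps)
  finally show "norm (L f) \<le> K * (nrm2 (lebesgue_on \<Omega>) f * sqrt (measure lebesgue (dball x r))) + e"
    by (simp add: N_def)
qed

lemma L_sum:
  fixes n :: nat
  assumes "\<And>j. j < n \<Longrightarrow> H1_atom \<Omega> D (a j)"
  shows "L (\<lambda>x. \<Sum>j<n. l j * a j x) = (\<Sum>j<n. l j * L (a j))"
  using assms
proof (induction n)
  case 0
  then show ?case using L_AE_zero(2)[of "\<lambda>x. 0"] by simp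
next
  case (Suc n)
  have "(\<lambda>x. \<Sum>j<n. l j * a j x) \<in> H1 \<Omega> D"
    using sum_atoms_H1_fin[of n a l] Suc.prems H1_fin_subset by (auto simp: less_Suc_eq)
  moreover have "(\<lambda>x. z * a n x) \<in> H1 \<Omega> D" for z
    using atom_H1_fin[OF Suc.prems[of n]] H1_fin_subset by auto
  note this[of "l n"] this[of 1]
  ultimately show ?case
    using Suc L_scale[of "a n" "l n"] L_add[of "\<lambda>x. \<Sum>j<n. l j * a j x" "\<lambda>x. l n * a n x"] by simp
qed

text \<open>Atoms are test functions, and \<open>L\<close> is linear and blind to null sets, so
  tests on single balls determine it on finite combinations.\<close>

lemma represented_by_of_tests:
  assumes hm: "h \<in> borel_measurable (lebesgue_on \<Omega>)"
    and int: "\<And>x r f. x \<in> \<Omega> \<Longrightarrow> 0 < r \<Longrightarrow> test x r f \<Longrightarrow> integrable (lebesgue_on \<Omega>) (\<lambda>y. h y * f y)"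
    and eq: "\<And>x r f. x \<in> \<Omega> \<Longrightarrow> 0 < r \<Longrightarrow> test x r f \<Longrightarrow> L f = (LINT y|lebesgue_on \<Omega>. h y * f y)"
  shows "represented_by \<Omega> D L h"
  unfolding represented_by_def
proof (intro ballI conjI)
  fix f assume "f \<in> H1_fin \<Omega> D"
  then obtain n :: nat and l a where atoms: "\<And>j. j < n \<Longrightarrow> H1_atom \<Omega> D (a j)"
    and f: "AE x in lebesgue_on \<Omega>. f x = (\<Sum>j<n. l j * a j x)"
    unfolding H1_fin_def by blast
  have a: "integrable (lebesgue_on \<Omega>) (\<lambda>y. h y * a j y)" "L (a j) = (LINT y|lebesgue_on \<Omega>. h y * a j y)"
    if "j < n" for j
    using atoms[OF that] int eq unfolding H1_atom_iff by blast+
  show "integrable (lebesgue_on \<Omega>) (\<lambda>x. h x * f x)"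
    by (rule H1_fin_pairing(1)[OF atoms f a(1) hm])
  have "L f = L (\<lambda>x. \<Sum>j<n. l j * a j x)"
    using sum_atoms_H1_fin[of n a l, OF atoms] H1_fin_subset f by (intro L_AE_cong) auto
  also have "\<dots> = (\<Sum>j<n. l j * L (a j))"
    by (rule L_sum[OF atoms])
  also have "\<dots> = (\<Sum>j<n. l j * (LINT x|lebesgue_on \<Omega>. h x * a j x))"
    by (simp add: a(2))
  also have "\<dots> = (LINT x|lebesgue_on \<Omega>. h x * f x)"
    by (rule H1_fin_pairing(2)[OF atoms f a(1) hm, symmetric])
  finally show "L f = (LINT x|lebesgue_on \<Omega>. h x * f x)" .
qed

theorem representation:
  "\<exists>h. h \<in> borel_measurable (lebesgue_on \<Omega>) \<and>
     (\<forall>S. bounded S \<and> S \<in> sets lebesgue \<and> S \<subseteq> \<Omega> \<longrightarrow> h \<in> sqint (lebesgue_on S)) \<and>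
     (\<forall>x\<in>\<Omega>. \<forall>r>0. \<forall>f. test x r f \<longrightarrow> L f = (LINT y|lebesgue_on \<Omega>. h y * f y))"
proof -
  obtain x0 where x0: "x0 \<in> \<Omega>" using nonempty by auto
  \<comment> \<open>Nearness is monotone in the radius: once the smallest ball of the exhaustion is
    near \<open>D\<close>, all are. If \<open>D \<inter> frontier \<Omega>\<close> is empty, any
    radius will do.\<close>
  obtain \<rho> where \<rho>: "0 < \<rho>" "D \<inter> frontier \<Omega> \<noteq> {} \<Longrightarrow> near x0 \<rho>"
  proof (cases "D \<inter> frontier \<Omega> = {}")
    case False
    then obtain p where "p \<in> D \<inter> frontier \<Omega>" by blast
    moreover have "p \<in> ball x0 (2 * (dist x0 p + 1))"
      by (simp add: distrib_left add_nonneg_pos)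
    ultimately have "near x0 (dist x0 p + 1)"
      unfolding near_def by blast
    then show ?thesis
      using that[of "dist x0 p + 1"] by (simp add: add_nonneg_pos)
  qed (use that[of 1] in simp)
  define R where "R n = \<rho> + real n" for n
  define S where "S n = dball x0 (R n)" for n
  have R: "0 < R n" for n using \<rho> by (simp add: R_def)
  have S_mono: "S n \<subseteq> S m" if "n \<le> m" for n m
    using that by (auto simp: S_def R_def)
  have S_sets [simp]: "S n \<in> sets lebesgue" and S_sub: "S n \<subseteq> \<Omega>" for n
    by (auto simp: S_def)
  have S_fin: "finite_measure (lebesgue_on (S n))" for n
    unfolding S_def by (rule finite_measure_dball)
  have S_ex: "\<exists>n. T \<subseteq> S n" if bdd: "bounded T" "T \<subseteq> \<Omega>" for T
  proof -
    obtain e where e: "\<And>y. y \<in> T \<Longrightarrow> dist x0 y \<le> e"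
      using bdd(1) bounded_any_center[of T x0] by blast
    obtain n where "e < real n" using reals_Archimedean2 by blast
    with e bdd(2) \<rho>(1) have "T \<subseteq> S n"
      unfolding S_def R_def by fastforce
    then show ?thesis ..
  qed
  have nearS: "near x0 (R n)" if "D \<inter> frontier \<Omega> \<noteq> {}" for n
    using \<rho>(2)[OF that] by (force simp: near_def R_def)
  note sets = S_sets sets_domain S_sub
  define \<phi> :: "'a \<Rightarrow> complex" where "\<phi> = (if D \<inter> frontier \<Omega> = {}
    then zero_outside (S 0) (\<lambda>y. of_real (1 / measure lebesgue (S 0))) else (\<lambda>y. 0))"
  have \<phi>s: "\<phi> \<in> sqint (lebesgue_on \<Omega>)"
  proof -
    have "(\<lambda>y. 0) \<in> sqint (lebesgue_on \<Omega>)"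
      by (simp add: sqint_def)
    then show ?thesis
      by (simp add: \<phi>_def sqint_zero_outside[OF sets] sqint_const[OF S_fin])
  qed
  have \<phi>0: "\<phi> y = 0" if "y \<notin> S n" for y n
    using that S_mono[of 0 n] by (auto simp: \<phi>_def zero_outside_def)
  have \<phi>1: "(LINT y|lebesgue_on \<Omega>. \<phi> y) = 1" if "D \<inter> frontier \<Omega> = {}"
  proof -
    have "0 < measure lebesgue (S 0)"
      unfolding S_def by (rule measure_dball_pos[OF x0 R])
    then show ?thesis
      using that by (simp add: \<phi>_def integral_zero_outside[OF sets] measure_restrict_space scaleR_conv_of_real)
  qed
  \<comment> \<open>If \<open>\<phi>\<close> has integral 1, \<open>T f\<close> has mean zero for
    integrable \<open>f\<close>; otherwise \<open>T\<close> is the identity.\<close>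
  define T where "T f y = f y - (LINT y|lebesgue_on \<Omega>. f y) * \<phi> y" for f :: "'a \<Rightarrow> complex" and y
  have ints: "integrable (lebesgue_on \<Omega>) (zero_outside (S n) f)" and
    intle: "norm (LINT y|lebesgue_on \<Omega>. zero_outside (S n) f y) \<le>
        nrm2 (lebesgue_on (S n)) f * nrm2 (lebesgue_on (S n)) (\<lambda>y. 1)"
    if f: "f \<in> sqint (lebesgue_on (S n))" for n f
  proof -
    have one: "(\<lambda>y. 1) \<in> sqint (lebesgue_on (S n))"
      by (rule sqint_const[OF S_fin])
    have "integrable (lebesgue_on (S n)) f"
      using sqint_mult_integrable[OF f one] by simp
    then show "integrable (lebesgue_on \<Omega>) (zero_outside (S n) f)"
      unfolding zero_outside_def[abs_def] by (simp add: integrable_if_zero_outside[OF sets])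
    show "norm (LINT y|lebesgue_on \<Omega>. zero_outside (S n) f y) \<le>
        nrm2 (lebesgue_on (S n)) f * nrm2 (lebesgue_on (S n)) (\<lambda>y. 1)"
      using sqint_norm_integral_le[OF f one] by (simp add: integral_zero_outside[OF sets])
  qed
  have Tsq: "T f \<in> sqint (lebesgue_on \<Omega>)" if "f \<in> sqint (lebesgue_on \<Omega>)" for f
    unfolding T_def by (intro sqint_diff sqint_scale \<phi>s that)
  have intphi: "integrable (lebesgue_on \<Omega>) \<phi>"
    by (auto simp: \<phi>_def intro!: ints sqint_const S_fin)
  have Ttest: "test x0 (R n) (T (zero_outside (S n) f))" if f: "f \<in> sqint (lebesgue_on (S n))" for n f
    unfolding test_def
  proof (intro conjI)
    show "T (zero_outside (S n) f) \<in> sqint (lebesgue_on \<Omega>)"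
      using f by (intro Tsq) (simp add: sqint_zero_outside[OF sets])
    show "AE y in lebesgue_on \<Omega>. y \<notin> dball x0 (R n) \<longrightarrow> T (zero_outside (S n) f) y = 0"
      using \<phi>0[of _ n] by (intro AE_I2) (simp add: T_def zero_outside_def flip: S_def)
    show "(LINT y|lebesgue_on \<Omega>. T (zero_outside (S n) f) y) = 0 \<or> near x0 (R n)"
      using \<phi>1 nearS[of n] ints[OF f] intphi by (cases "D \<inter> frontier \<Omega> = {}") (auto simp: T_def)
  qed
  then have TH: "T (zero_outside (S n) f) \<in> H1 \<Omega> D" if "f \<in> sqint (lebesgue_on (S n))" for n f
    using test_H1_fin[OF x0 R] H1_fin_subset that by blast
  \<comment> \<open>Riesz for \<open>L\<close> composed with zero extension and \<open>T\<close>.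
    This is linear because \<open>T\<close> is linear on integrable functions, and bounded by
    \<open>L_test_bound\<close> on the ball \<open>S n\<close>.\<close>
  have "\<exists>h\<in>sqint (lebesgue_on (S n)). \<forall>f\<in>sqint (lebesgue_on (S n)).
      L (T (zero_outside (S n) f)) = (LINT y|lebesgue_on (S n). h y * f y)" for n
  proof (rule sqint_Riesz[OF S_fin])
    let ?L = "lebesgue_on (S n)"
    fix f g assume f: "f \<in> sqint ?L" and g: "g \<in> sqint ?L"
    have z: "zero_outside (S n) (\<lambda>x. f x + g x) = (\<lambda>x. zero_outside (S n) f x + zero_outside (S n) g x)"
      by (auto simp: zero_outside_def)
    have "T (zero_outside (S n) (\<lambda>x. f x + g x)) =
        (\<lambda>x. T (zero_outside (S n) f) x + T (zero_outside (S n) g) x)"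
      unfolding z using ints[OF f] ints[OF g] by (auto simp: T_def algebra_simps)
    then show "L (T (zero_outside (S n) (\<lambda>x. f x + g x))) =
        L (T (zero_outside (S n) f)) + L (T (zero_outside (S n) g))"
      by (simp add: L_add TH f g)
  next
    let ?L = "lebesgue_on (S n)"
    fix c f assume f: "f \<in> sqint ?L"
    have z: "zero_outside (S n) (\<lambda>x. c * f x) = (\<lambda>x. c * zero_outside (S n) f x)"
      by (auto simp: zero_outside_def)
    have "T (zero_outside (S n) (\<lambda>x. c * f x)) = (\<lambda>x. c * T (zero_outside (S n) f) x)"
      unfolding z by (auto simp: T_def algebra_simps)
    then show "L (T (zero_outside (S n) (\<lambda>x. c * f x))) = c * L (T (zero_outside (S n) f))"
      by (simp add: L_scale TH f)
  next
    let ?L = "lebesgue_on (S n)"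
    \<comment> \<open>Comes from \<open>|a - b|^2 \<le> 2|a|^2 + 2|b|^2\<close> and the
      Cauchy-Schwarz bound \<open>intle\<close> for the integral.\<close>
    let ?C = "sqrt (2 + 2 * (nrm2 ?L (\<lambda>y. 1) * nrm2 (lebesgue_on \<Omega>) \<phi>)\<^sup>2)"
    fix f assume f: "f \<in> sqint ?L"
    let ?F = "zero_outside (S n) f"
    let ?I = "LINT y|lebesgue_on \<Omega>. ?F y"
    have F: "?F \<in> sqint (lebesgue_on \<Omega>)"
      using f by (simp add: sqint_zero_outside[OF sets])
    have le: "(norm (a - b))\<^sup>2 \<le> 2 * (norm a)\<^sup>2 + 2 * (norm b)\<^sup>2" for a b :: complex
      using norm_add_power2_le[of a "- b"] by simp
    have "(nrm2 (lebesgue_on \<Omega>) (T ?F))\<^sup>2 \<le>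
        (LINT y|lebesgue_on \<Omega>. 2 * (norm (?F y))\<^sup>2 + 2 * (norm (?I * \<phi> y))\<^sup>2)"
      unfolding nrm2_power2
      by (intro Bochner_Integration.integral_mono sqint_integrable Tsq F Bochner_Integration.integrable_add
          integrable_mult_right sqint_scale \<phi>s) (simp add: T_def le)
    also have "\<dots> = 2 * (nrm2 ?L f)\<^sup>2 + 2 * (norm ?I * nrm2 (lebesgue_on \<Omega>) \<phi>)\<^sup>2"
      using sqint_integrable[OF F] sqint_integrable[OF sqint_scale[OF \<phi>s, of ?I]]
      by (simp add: nrm2_zero_outside[OF sets] flip: nrm2_power2 nrm2_scale)
    also have "\<dots> \<le> 2 * (nrm2 ?L f)\<^sup>2 + 2 * ((nrm2 ?L f * nrm2 ?L (\<lambda>y. 1)) * nrm2 (lebesgue_on \<Omega>) \<phi>)\<^sup>2"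
      by (intro add_mono mult_left_mono power_mono mult_right_mono intle f order_refl) auto
    also have "\<dots> = (?C * nrm2 ?L f)\<^sup>2"
      by (simp add: power_mult_distrib algebra_simps)
    finally have Tle: "nrm2 (lebesgue_on \<Omega>) (T ?F) \<le> ?C * nrm2 ?L f"
      by (rule power2_le_imp_le) simp
    have "norm (L (T ?F)) \<le> K * (nrm2 (lebesgue_on \<Omega>) (T ?F) * sqrt (measure lebesgue (dball x0 (R n))))"
      by (rule L_test_bound[OF x0 R Ttest[OF f]])
    also have "\<dots> \<le> K * ((?C * nrm2 ?L f) * sqrt (measure lebesgue (dball x0 (R n))))"
      by (intro mult_left_mono mult_right_mono Tle K_nonneg) auto
    finally show "norm (L (T ?F)) \<le> (K * ?C * sqrt (measure lebesgue (dball x0 (R n)))) * nrm2 ?L f"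
      by (simp add: mult_ac)
  qed
  then obtain H where H: "\<And>n. H n \<in> sqint (lebesgue_on (S n))"
    and LH: "\<And>n f. f \<in> sqint (lebesgue_on (S n)) \<Longrightarrow>
      L (T (zero_outside (S n) f)) = (LINT y|lebesgue_on (S n). H n y * f y)"
    by metis
  \<comment> \<open>A function on \<open>S n\<close> has the same zero extension to
    \<open>\<Omega>\<close> directly or through \<open>S m\<close>, so \<open>H n\<close> and
    \<open>H m\<close> give the same functional on \<open>S n\<close>; testing with the conjugate of
    their difference shows the difference to be null.\<close>
  have consistent: "AE y in lebesgue_on \<Omega>. y \<in> S n \<longrightarrow> H n y = H m y" if nm: "n \<le> m" for n m
  proof -
    let ?L = "lebesgue_on (S n)"
    define d where "d y = H n y - H m y" for y
    define f where "f y = cnj (d y)" for y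
    have nmsets: "S n \<in> sets lebesgue" "S m \<in> sets lebesgue" "S n \<subseteq> S m"
      using S_mono[OF nm] by auto
    have Hm: "H m \<in> sqint ?L"
      by (rule sqint_subset[OF nmsets H])
    have d: "d \<in> sqint ?L"
      unfolding d_def by (rule sqint_diff[OF H Hm])
    have f: "f \<in> sqint ?L"
      unfolding f_def by (rule sqint_cnj[OF d])
    have zz: "zero_outside (S m) (zero_outside (S n) f) = zero_outside (S n) f"
      using nmsets(3) by (auto simp: zero_outside_def fun_eq_iff)
    have fm: "zero_outside (S n) f \<in> sqint (lebesgue_on (S m))"
      using f by (simp add: sqint_zero_outside[OF nmsets])
    have "(LINT y|?L. H n y * f y) = L (T (zero_outside (S n) f))"
      using LH[OF f] by simp
    also have "\<dots> = (LINT y|lebesgue_on (S m). H m y * zero_outside (S n) f y)"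
      using LH[OF fm] by (simp add: zz)
    also have "\<dots> = (LINT y|?L. H m y * zero_outside (S n) f y)"
      by (rule integral_pairing(2)[OF nmsets sqint_measurable[OF H] Hm fm]) (simp add: zero_outside_def)
    also have "\<dots> = (LINT y|?L. H m y * f y)"
      by (rule Bochner_Integration.integral_cong) (auto simp: zero_outside_def)
    finally have "(LINT y|?L. d y * f y) = 0"
      using sqint_mult_integrable[OF H f] sqint_mult_integrable[OF Hm f]
      by (simp add: d_def left_diff_distrib)
    moreover have "d y * f y = of_real ((norm (d y))\<^sup>2)" for y
      by (simp only: f_def complex_norm_square)
    ultimately have "(LINT y|?L. (norm (d y))\<^sup>2) = 0"
      by (simp only: Bochner_Integration.integral_complex_of_real of_real_eq_0_iff)
    then have "AE y in ?L. (norm (d y))\<^sup>2 = 0"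
      using integral_nonneg_eq_0_iff_AE[OF sqint_integrable[OF d]] by simp
    then have "AE y in lebesgue. y \<in> S n \<longrightarrow> d y = 0"
      by (simp add: AE_restrict_space_iff)
    then show ?thesis
      unfolding AE_domain_iff by eventually_elim (simp add: d_def)
  qed
  \<comment> \<open>At almost every point the sequence is eventually constant, from the first
    \<open>n\<close> with the point in \<open>S n\<close> on.\<close>
  define h where "h y = lim (\<lambda>n. zero_outside (S n) (H n) y)" for y
  have hm: "h \<in> borel_measurable (lebesgue_on \<Omega>)"
    unfolding h_def
    by (rule borel_measurable_lim_metric) (simp add: borel_measurable_zero_outside[OF sets] sqint_measurable[OF H])
  \<comment> \<open>Countably many pairs of indices, hence one common null set.\<close>
  have "AE y in lebesgue_on \<Omega>. \<forall>n m. n \<le> m \<longrightarrow> y \<in> S n \<longrightarrow> H n y = H m y"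
    unfolding AE_all_countable using consistent by (auto intro: AE_I2)
  then have hH: "AE y in lebesgue_on \<Omega>. \<forall>n. y \<in> S n \<longrightarrow> h y = H n y"
  proof eventually_elim
    case (elim y)
    show ?case
    proof (intro allI impI)
      fix n assume y: "y \<in> S n"
      have "zero_outside (S m) (H m) y = H n y" if "n \<le> m" for m
        using S_mono[OF that] y elim that by (auto simp: zero_outside_def)
      then have "(\<lambda>n. zero_outside (S n) (H n) y) \<longlonglongrightarrow> H n y"
        by (intro tendsto_eventually eventually_sequentiallyI[of n])
      then show "h y = H n y"
        by (simp add: h_def limI)
    qed
  qed
  have hS: "h \<in> sqint (lebesgue_on (S n))" and
    hpair: "f \<in> sqint (lebesgue_on (S n)) \<Longrightarrow>
      (LINT y|lebesgue_on (S n). h y * f y) = (LINT y|lebesgue_on (S n). H n y * f y)" for n f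
  proof -
    have "AE y in lebesgue. y \<in> \<Omega> \<longrightarrow> (\<forall>n. y \<in> S n \<longrightarrow> h y = H n y)"
      using hH by (simp add: AE_domain_iff)
    then have "AE y in lebesgue. y \<in> S n \<longrightarrow> h y = H n y"
      by eventually_elim (use S_sub in blast)
    then have ae: "AE y in lebesgue_on (S n). h y = H n y"
      by (simp add: AE_restrict_space_iff)
    have m: "h \<in> borel_measurable (lebesgue_on (S n))"
      by (rule measurable_restrict_mono[OF hm S_sub])
    have "integrable (lebesgue_on (S n)) (\<lambda>y. (norm (h y))\<^sup>2)"
      by (rule integrable_cong_AE_imp[OF sqint_integrable[OF H]])
        (use m in measurable, use ae in \<open>eventually_elim; simp\<close>)
    with m show "h \<in> sqint (lebesgue_on (S n))"
      by (simp add: sqint_def)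
    assume f: "f \<in> sqint (lebesgue_on (S n))"
    show "(LINT y|lebesgue_on (S n). h y * f y) = (LINT y|lebesgue_on (S n). H n y * f y)"
    proof (rule integral_cong_AE)
      show "(\<lambda>y. h y * f y) \<in> borel_measurable (lebesgue_on (S n))"
        using m sqint_measurable[OF f] by measurable
      show "(\<lambda>y. H n y * f y) \<in> borel_measurable (lebesgue_on (S n))"
        using sqint_measurable[OF H] sqint_measurable[OF f] by measurable
      show "AE y in lebesgue_on (S n). h y * f y = H n y * f y"
        using ae by eventually_elim simp
    qed
  qed
  have hbdd: "h \<in> sqint (lebesgue_on U)" if U: "bounded U" "U \<in> sets lebesgue" "U \<subseteq> \<Omega>" for U
  proof -
    obtain n where "U \<subseteq> S n" using S_ex[OF U(1,3)] by blast
    from sqint_subset[OF U(2) S_sets this hS] show ?thesis .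
  qed
  have "L f = (LINT y|lebesgue_on \<Omega>. h y * f y)" if x: "x \<in> \<Omega>" "0 < r" and f: "test x r f" for x r f
  proof -
    have fs: "f \<in> sqint (lebesgue_on \<Omega>)" and ae: "AE y in lebesgue_on \<Omega>. y \<notin> dball x r \<longrightarrow> f y = 0"
      and f0: "(LINT y|lebesgue_on \<Omega>. f y) = 0 \<or> near x r"
      using f by (auto simp: test_def)
    have "bounded (dball x r)"
      by (rule bounded_subset[OF bounded_ball]) auto
    then obtain n where n: "dball x r \<subseteq> S n"
      using S_ex[of "dball x r"] by auto
    have aeS: "AE y in lebesgue_on \<Omega>. y \<notin> S n \<longrightarrow> f y = 0"
      using ae by eventually_elim (use n in blast)
    have fS: "f \<in> sqint (lebesgue_on (S n))"
      by (rule sqint_subset[OF sets fs])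
    have one: "(\<lambda>y. 1) \<in> sqint (lebesgue_on (S n))"
      by (rule sqint_const[OF S_fin])
    have int_eq: "(LINT y|lebesgue_on \<Omega>. zero_outside (S n) f y) = (LINT y|lebesgue_on \<Omega>. f y)"
      using integral_pairing(2)[OF sets _ one fs aeS] by (simp add: integral_zero_outside[OF sets])
    \<comment> \<open>The correction vanishes on genuine test functions: if no ball is near,
      \<open>f\<close> must have mean zero; otherwise \<open>\<phi>\<close> is zero.\<close>
    have "T (zero_outside (S n) f) = zero_outside (S n) f"
    proof (cases "D \<inter> frontier \<Omega> = {}")
      case True
      then have "\<not> near x r" by (simp add: near_def)
      with f0 show ?thesis by (simp add: fun_eq_iff T_def int_eq)
    next
      case False
      then show ?thesis by (simp add: fun_eq_iff T_def \<phi>_def)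
    qed
    \<comment> \<open>\<open>f\<close> vanishes off \<open>S n\<close> only almost everywhere, hence
      \<open>L_AE_cong\<close>.\<close>
    moreover have "L (zero_outside (S n) f) = L f"
      using test_H1_fin[OF x f] H1_fin_subset zero_outside_AE_eq[OF sets aeS]
      by (intro L_AE_cong) (auto elim!: eventually_mono)
    ultimately have "L f = (LINT y|lebesgue_on (S n). H n y * f y)"
      using LH[OF fS] by simp
    also have "\<dots> = (LINT y|lebesgue_on \<Omega>. h y * f y)"
      using integral_pairing(2)[OF sets hm hS fs aeS] hpair[OF fS] by simp
    finally show ?thesis .
  qed
  then show ?thesis
    using hm hbdd by blast
qed

end

theorem theorem4p10:
  fixes \<Omega> D :: "'a::euclidean_space set"
  assumes "DIM('a) \<ge> 2"
    and "open \<Omega>" and "closed D" and "D \<subseteq> frontier \<Omega>"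
    and "UITC \<Omega>"
    and "\<exists>!C. C \<in> D_components \<Omega> D"
  shows "(\<exists>c>0. \<forall>g\<in>BMO \<Omega> D. \<exists>L\<in>H1_dual \<Omega> D.
             represented_by \<Omega> D L g \<and>
             ennreal (H1_dual_norm \<Omega> D L) \<le> ennreal c * BMO_seminorm \<Omega> D g) \<and>
         (\<exists>c>0. \<forall>L\<in>H1_dual \<Omega> D. \<exists>h\<in>BMO \<Omega> D.
             represented_by \<Omega> D L h \<and>
             BMO_seminorm \<Omega> D h \<le> ennreal (c * H1_dual_norm \<Omega> D L) \<and>
             (\<forall>h'\<in>BMO \<Omega> D. represented_by \<Omega> D L h' \<longrightarrow>
                BMO_seminorm \<Omega> D (\<lambda>x. h x - h' x) = 0))"
proof -
  have comps: "D_components \<Omega> D = {\<Omega>}"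
    by (rule unique_D_component) fact
  \<comment> \<open>The empty set is removed in \<open>D_components\<close>.\<close>
  then have "\<Omega> \<noteq> {}"
    by (auto simp: D_components_def)
  then interpret one_component \<Omega> D
    using comps \<open>open \<Omega>\<close> by unfold_locales
  \<comment> \<open>Both directions hold with constant 1.\<close>
  have "\<exists>L\<in>H1_dual \<Omega> D. represented_by \<Omega> D L g \<and>
      ennreal (H1_dual_norm \<Omega> D L) \<le> ennreal 1 * BMO_seminorm \<Omega> D g" if g: "g \<in> BMO \<Omega> D" for g
  proof -
    obtain L where L: "L \<in> H1_dual \<Omega> D" "represented_by \<Omega> D L g"
      and le: "H1_dual_norm \<Omega> D L \<le> enn2real (BMO_seminorm \<Omega> D g)"
      using BMO_represents_functional[OF BMO_osc_bound[OF g]] by blast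
    have "ennreal (enn2real (BMO_seminorm \<Omega> D g)) = BMO_seminorm \<Omega> D g"
      using g by (simp add: BMO_def)
    with ennreal_leI[OF le] L show ?thesis
      by (intro bexI[of _ L]) simp_all
  qed
  moreover have "\<exists>h\<in>BMO \<Omega> D. represented_by \<Omega> D L h \<and>
      BMO_seminorm \<Omega> D h \<le> ennreal (1 * H1_dual_norm \<Omega> D L) \<and>
      (\<forall>h'\<in>BMO \<Omega> D. represented_by \<Omega> D L h' \<longrightarrow> BMO_seminorm \<Omega> D (\<lambda>x. h x - h' x) = 0)"
    if L: "L \<in> H1_dual \<Omega> D" for L
  proof -
    interpret H1_functional \<Omega> D L
      by unfold_locales fact
    obtain h where hm: "h \<in> borel_measurable (lebesgue_on \<Omega>)"
      and hS: "\<forall>S. bounded S \<and> S \<in> sets lebesgue \<and> S \<subseteq> \<Omega> \<longrightarrow> h \<in> sqint (lebesgue_on S)"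
      and "\<forall>x\<in>\<Omega>. \<forall>r>0. \<forall>f. test x r f \<longrightarrow> L f = (LINT y|lebesgue_on \<Omega>. h y * f y)"
      using representation by (elim exE conjE)
    then have Lh: "L f = (LINT y|lebesgue_on \<Omega>. h y * f y)" if "x \<in> \<Omega>" "0 < r" "test x r f" for x r f
      using that by blast
    have hB: "h \<in> sqint (lebesgue_on (dball x r))" for x r
      using hS by (auto intro: bounded_subset[OF bounded_ball])
    have semi: "BMO_seminorm \<Omega> D h \<le> ennreal (H1_dual_norm \<Omega> D L)"
    proof (rule BMO_seminorm_le[OF hm hB K_nonneg])
      fix x r f assume "x \<in> \<Omega>" "0 < r" "test x r f"
      from L_test_bound[OF this] Lh[OF this]
      show "norm (LINT y|lebesgue_on \<Omega>. h y * f y) \<le>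
          H1_dual_norm \<Omega> D L * (nrm2 (lebesgue_on \<Omega>) f * sqrt (measure lebesgue (dball x r)))"
        by simp
    qed
    \<comment> \<open>The seminorm bound puts \<open>h\<close> into \<open>BMO\<close>; its
      oscillation bound then yields the integrability against test functions that
      \<open>represented_by\<close> demands.\<close>
    then have hBMO: "h \<in> BMO \<Omega> D"
      using hm hS le_less_trans[OF semi] by (auto simp: BMO_def sqint_def)
    have rep: "represented_by \<Omega> D L h"
      by (rule represented_by_of_tests[OF hm test_pairing(1)[OF BMO_osc_bound[OF hBMO]] Lh])
    have "BMO_seminorm \<Omega> D (\<lambda>x. h x - h' x) = 0"
      if h': "h' \<in> BMO \<Omega> D" "represented_by \<Omega> D L h'" for h'
    proof -
      \<comment> \<open>Both functions represent \<open>L\<close>, so their difference pairs to zero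
        with every test function, and the duality bound applies with \<open>M = 0\<close>.\<close>
      have "BMO_seminorm \<Omega> D (\<lambda>x. h x - h' x) \<le> ennreal 0"
      proof (rule BMO_seminorm_le)
        show "(\<lambda>x. h x - h' x) \<in> borel_measurable (lebesgue_on \<Omega>)"
          using hm BMO_sqint(1)[OF h'(1)] by measurable
        show "(\<lambda>x. h x - h' x) \<in> sqint (lebesgue_on (dball x r))" for x r
          by (rule sqint_diff[OF hB BMO_sqint(2)[OF h'(1)]])
        fix x r f assume "x \<in> \<Omega>" "0 < r" "test x r f"
        then have f: "f \<in> H1_fin \<Omega> D"
          by (rule test_H1_fin)
        then have "(LINT y|lebesgue_on \<Omega>. (h y - h' y) * f y) = L f - L f"
          using rep h'(2) by (simp add: represented_by_def left_diff_distrib)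
        then show "norm (LINT y|lebesgue_on \<Omega>. (h y - h' y) * f y) \<le>
            0 * (nrm2 (lebesgue_on \<Omega>) f * sqrt (measure lebesgue (dball x r)))"
          by simp
      qed simp
      then show ?thesis by simp
    qed
    with hBMO rep semi show ?thesis
      by (intro bexI[of _ h]) simp_all
  qed
  ultimately show ?thesis
    by (intro conjI exI[of _ 1]) simp_all
qed

end
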